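(* Fix a sequence of square matrices $\{A_j : j = 1,\dots,J\} \subset \mathbb{M}^{n\times n}$. Let $\{Q_j : j=1,\dots,J\} \subset \mathbb{M}^{n\times n}$ be an independent family of random orthogonal matrices, and let $\{G_j : j = 1,\dots,J\} \subset \mathbb{M}^{n\times n}$ be an independent family of normalized Gaussian matrices. Then for each nonnegative, sublinear, convex function $\lvert\cdot\rvert : \mathbb{M}^{n\times n} \to \mathbb{R}$ and each weakly increasing, convex function $\Phi : \mathbb{R}\to\mathbb{R}$, $$\mathbb{E}\,\Phi\left(\left\lvert \sum_{j=1}^J Q_j A_j \right\rvert\right) \le \mathbb{E}\,\Phi\left(1.5 \left\lvert \sum_{j=1}^J G_j A_j \right\rvert\right).$$
   Context: $\mathbb{M}^{n\times n}$ is the space of real $n\times n$ matrices. A random orthogonal matrix is one distributed according to the Haar probability measure on the set $\mathbb{V}_n^n = \{Q\in\mathbb{M}^{n\times n} : Q^*Q = \mathrm{I}\}$ of orthogonal matrices. A normalized Gaussian matrix in $\mathbb{M}^{n\times n}$ has independent $\mathrm{N}(0,n^{-1})$ entries (mean zero, variance $n^{-1}$). A convex function is called sublinear when it is positive homogeneous, i.e. $\lvert tA\rvert = t\lvert A\rvert$ for $t>0$. The expectation on the right-hand side may equal $+\infty$. *)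

theory Defs
  imports "HOL-Probability.Probability"
begin

(* The Haar probability measure of the orthogonal group, viewed as a Borel measure on the
   space of all matrices that is carried by the orthogonal group.  The group is compact, so
   left invariance alone characterizes this measure uniquely (and implies right invariance). *)
definition haar_orthogonal :: "(real^'n^'n) measure \<Rightarrow> bool" where
  "haar_orthogonal \<mu> \<longleftrightarrow>
     prob_space \<mu> \<and> sets \<mu> = sets borel \<and>
     emeasure \<mu> {Q. orthogonal_matrix Q} = 1 \<and>
     (\<forall>U. orthogonal_matrix U \<longrightarrow> distr \<mu> borel (\<lambda>Q. U ** Q) = \<mu>)"

definition random_orthogonal_matrix :: "'a measure \<Rightarrow> ('a \<Rightarrow> real^'n^'n) \<Rightarrow> bool" where
  "random_orthogonal_matrix M Q \<longleftrightarrow>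
     Q \<in> borel_measurable M \<and> haar_orthogonal (distr M borel Q)"

(* The second argument of normal_density is the standard deviation, so the variance of each
   entry is the reciprocal of the matrix size. *)
definition normalized_gaussian_matrix :: "'a measure \<Rightarrow> ('a \<Rightarrow> real^'n^'n) \<Rightarrow> bool" where
  "normalized_gaussian_matrix M G \<longleftrightarrow>
     prob_space.indep_vars M (\<lambda>_. borel) (\<lambda>(i, k) \<omega>. G \<omega> $ i $ k) UNIV \<and>
     (\<forall>i k. distributed M lborel (\<lambda>\<omega>. G \<omega> $ i $ k)
              (normal_density 0 (1 / sqrt (real CARD('n)))))"

definition sublinear :: "('v::real_vector \<Rightarrow> real) \<Rightarrow> bool" where
  "sublinear f \<longleftrightarrow>
     convex_on UNIV f \<and> (\<forall>t>0. \<forall>x. f (t *\<^sub>R x) = t * f x)"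

(* The expectation as an extended real, i.e. the integral of the positive part minus the
   integral of the negative part.  It is meaningful whenever one of the two is finite, in
   particular for every random variable that is bounded below, and may then be infinite
   (whereas the Bochner integral of a nonintegrable function is 0). *)
definition ext_expectation :: "'a measure \<Rightarrow> ('a \<Rightarrow> real) \<Rightarrow> ereal" where
  "ext_expectation M X =
     enn2ereal (\<integral>\<^sup>+ \<omega>. ennreal (X \<omega>) \<partial>M) - enn2ereal (\<integral>\<^sup>+ \<omega>. ennreal (- X \<omega>) \<partial>M)"

end

theory Submission imports Defs begin

text \<open>
  Expectations of nonnegative convex functions of the $Q_j$ increase when the $Q_j$ are replaced,
  one after the other, by $1.5\, G_j$. For a single Gaussian matrix $G$, take orthogonal $W$ such that
  $GW = P$ is positive semidefinite. Since $G$ and $VGQ$ have the same law for orthogonal $V$ and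
  Haar distributed $Q$, and $Q$ may be replaced by $W V^* Q$, Jensen's inequality allows one to
  average $V P V^*$ over $V$ and then over $G$, which gives $\mathbb{E} h(1.5\,G) \ge \mathbb{E} h(c\,Q)$ with
  $c = 1.5\, n^{-1}\, \mathbb{E}\,\mathrm{tr} P$; it remains to see that $c \ge 1$.
  For every $x > 0$ one has $\mathrm{tr} P \ge 3 \|G\|^2 / (2x) - \|G G^*\|^2 / (2 x^3)$ with
  Frobenius norms, because $\mathrm{tr}\, (P - x) (P^2 + 2 x P) (P - x) \ge 0$. Take $x$ proportional to
  $\|G\|$; the mean of the right-hand side is then a multiple of $\mathbb{E} \|G\|$, and
  the moment recursion $\mathbb{E} \|G\|^3 = (n + 1/n)\, \mathbb{E} \|G\|$ bounds it below by $2n/3$.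
\<close>

section \<open>The standard Gaussian measure\<close>

text \<open>The factor \<open>W\<close> depends on \<open>G\<close>, and a measurable choice of it
  would be awkward. It is therefore used only for one fixed \<open>G\<close> at a time: after
  integration over \<open>Q\<close> the trace of \<open>P\<close> is at once replaced by a lower
  bound in the norms of \<open>G\<close> and \<open>G ** transpose G\<close>, which is measurable
  and has a computable mean. The polynomial is tuned to this: (P - x)(P^2 + 2xP)(P - x) = P^4 - 3x^2
  P^2 + 2x^3 P has no cubic term, and P^2 = \<open>G ** transpose G\<close> no longer contains
  \<open>W\<close>. Making x proportional to the norm gives every term degree one, so that
  orthogonal symmetry determines the mean of the quartic term up to the mean norm. For normalized
  \<open>G\<close> the resulting bound on the mean trace is asymptotically n / sqrt 2. Since 1 /
  sqrt 2 exceeds 2/3 there is room for 2n/3 in every dimension, and 1.5 is the reciprocal of 2/3.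
  Turning \<open>V ** P ** transpose V\<close> into a multiple of the identity takes only the finite
  group of signed permutation matrices, so Jensen's inequality for finite sums is enough there. All
  computations use unit variance; the factor 1 / sqrt n is moved into the argument of the convex
  function.\<close>

definition std_gaussian :: "'a::euclidean_space measure" where
  "std_gaussian = density lborel (\<lambda>z. ennreal (\<Prod>b\<in>Basis. std_normal_density (z \<bullet> b)))"

lemma norm_power2_Basis: "(norm (z::'a::euclidean_space))\<^sup>2 = (\<Sum>b\<in>Basis. (z \<bullet> b)\<^sup>2)"
  by (subst power2_norm_eq_inner, subst euclidean_inner) (simp add: power2_eq_square)

text \<open>Only the norm enters: this radial form makes norm-preserving linear maps symmetries of
  the measure and lets dilations act on the exponent alone.\<close>

lemma prod_std_normal_density:
  fixes z :: "'a::euclidean_space"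
  shows "(\<Prod>b\<in>Basis. std_normal_density (z \<bullet> b)) =
    (1 / sqrt (2 * pi)) ^ DIM('a) * exp (- (norm z)\<^sup>2 / 2)"
proof -
  have "(\<Prod>b\<in>Basis. std_normal_density (z \<bullet> b))
      = (\<Prod>b\<in>(Basis::'a set). 1 / sqrt (2 * pi)) * (\<Prod>b\<in>Basis. exp (- (z \<bullet> b)\<^sup>2 / 2))"
    unfolding normal_density_def prod.distrib[symmetric] by simp
  also have "(\<Prod>b\<in>Basis. exp (- (z \<bullet> b)\<^sup>2 / 2)) = exp (\<Sum>b\<in>Basis. - (z \<bullet> b)\<^sup>2 / 2)"
    by (simp add: exp_sum)
  also have "(\<Sum>b\<in>Basis. - (z \<bullet> b)\<^sup>2 / 2) = - (norm z)\<^sup>2 / 2"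
    by (simp add: norm_power2_Basis sum_negf sum_divide_distrib)
  finally show ?thesis by simp
qed

lemma std_gaussian_altdef:
  "(std_gaussian :: 'a::euclidean_space measure) = density lborel (\<lambda>z. ennreal
     ((1 / sqrt (2 * pi)) ^ DIM('a) * exp (- (norm z)\<^sup>2 / 2)))"
  by (simp only: std_gaussian_def prod_std_normal_density)

lemma sets_std_gaussian [simp, measurable_cong]: "sets std_gaussian = sets borel"
  by (simp add: std_gaussian_def)

lemma space_std_gaussian [simp]: "space std_gaussian = UNIV"
  by (simp add: std_gaussian_def)

text \<open>Density and integrand both factor over the coordinates. Used for the total mass and for
  the probabilities of boxes.\<close>

lemma nn_integral_std_gaussian_prod:
  fixes g :: "'a::euclidean_space \<Rightarrow> real \<Rightarrow> ennreal"
  assumes [measurable]: "\<And>b. g b \<in> borel_measurable borel"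
  shows "(\<integral>\<^sup>+z. (\<Prod>b\<in>Basis. g b (z \<bullet> b)) \<partial>std_gaussian) =
    (\<Prod>b\<in>Basis. \<integral>\<^sup>+x. g b x \<partial>density lborel std_normal_density)"
proof -
  have "(\<integral>\<^sup>+z. (\<Prod>b\<in>Basis. g b (z \<bullet> b)) \<partial>std_gaussian) =
     (\<integral>\<^sup>+z. (\<Prod>b\<in>Basis. ennreal (std_normal_density (z \<bullet> b)) * g b (z \<bullet> b)) \<partial>lborel)"
    unfolding std_gaussian_def
    by (subst nn_integral_density) (auto simp: prod.distrib prod_ennreal)
  also have "\<dots> = (\<Prod>b\<in>Basis. \<integral>\<^sup>+x. ennreal (std_normal_density x) * g b x \<partial>lborel)"
    by (rule nn_integral_lborel_prod[where f = "\<lambda>b x. ennreal (std_normal_density x) * g b x"]) auto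
  finally show ?thesis by (simp add: nn_integral_density)
qed

lemma prob_space_std_gaussian: "prob_space (std_gaussian :: 'a::euclidean_space measure)"
proof
  have 1: "emeasure (density lborel std_normal_density) (space (density lborel std_normal_density)) = 1"
    by (rule prob_space.emeasure_space_1) (rule prob_space_normal_density, simp)
  have "emeasure (std_gaussian :: 'a measure) (space std_gaussian) =
     (\<integral>\<^sup>+z. (\<Prod>b\<in>(Basis::'a set). 1) \<partial>(std_gaussian :: 'a measure))"
    by simp
  also have "\<dots> = (\<Prod>b\<in>(Basis::'a set). \<integral>\<^sup>+x. 1 \<partial>density lborel std_normal_density)"
    by (rule nn_integral_std_gaussian_prod) simp
  finally show "emeasure (std_gaussian :: 'a measure) (space std_gaussian) = 1"
    using 1 by simp
qed

text \<open>Tonelli shows that a translation invariant measure is a multiple of Lebesgue measure,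
  and the unit ball fixes the factor.\<close>

lemma distr_lborel_orthogonal:
  fixes T :: "'a::euclidean_space \<Rightarrow> 'a"
  assumes T: "orthogonal_transformation T"
  shows "distr lborel borel T = lborel"
proof (rule measure_eqI)
  have lin: "linear T" by (rule orthogonal_transformation_linear[OF T])
  then have m [measurable]: "T \<in> borel \<rightarrow>\<^sub>M borel"
    by (intro borel_measurable_continuous_onI linear_continuous_on) (simp add: linear_conv_bounded_linear)
  define \<nu> where "\<nu> = distr lborel borel T"
  have [simp, measurable_cong]: "sets \<nu> = sets borel" and [simp]: "space \<nu> = UNIV"
    by (simp_all add: \<nu>_def)
  have inv: "orthogonal_transformation (inv T)" by (rule orthogonal_transformation_inv[OF T])
  have Ti: "T (inv T y) = y" for y
    using orthogonal_transformation_surj[OF T] by (rule surj_f_inv_f)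
  have transl: "(\<integral>\<^sup>+x. f (c + x) \<partial>lborel) = (\<integral>\<^sup>+x. f x \<partial>lborel)"
    if [measurable]: "f \<in> borel_measurable borel" for f :: "'a \<Rightarrow> ennreal" and c
    by (subst (2) lborel_distr_plus[of c, symmetric]) (simp add: nn_integral_distr)
  \<comment> \<open>Since \<open>T\<close> is onto, translation by \<open>c\<close> on the image
    side is translation by \<open>inv T c\<close> before \<open>T\<close>, so \<nu> inherits
    translation invariance.\<close>
  have transl\<nu>: "(\<integral>\<^sup>+x. f (c + x) \<partial>\<nu>) = (\<integral>\<^sup>+x. f x \<partial>\<nu>)"
    if [measurable]: "f \<in> borel_measurable borel" for f :: "'a \<Rightarrow> ennreal" and c
  proof -
    have "(\<integral>\<^sup>+x. f (c + x) \<partial>\<nu>) = (\<integral>\<^sup>+x. f (T (inv T c + x)) \<partial>lborel)"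
      by (simp add: \<nu>_def nn_integral_distr linear_add[OF lin] Ti)
    also have "\<dots> = (\<integral>\<^sup>+x. f (T x) \<partial>lborel)"
      by (rule transl[of "\<lambda>x. f (T x)"]) simp
    finally show ?thesis by (simp add: \<nu>_def nn_integral_distr)
  qed
  have ball: "emeasure \<nu> (ball 0 r) = emeasure lborel (ball (0::'a) r)" for r
  proof -
    have "T -` ball 0 r = ball 0 r"
      by (auto simp: orthogonal_transformation_norm[OF T])
    then show ?thesis by (simp add: \<nu>_def emeasure_distr)
  qed
  have fin: "emeasure lborel (ball (0::'a) r) \<noteq> \<infinity>" for r
    using emeasure_lborel_ball_finite[of "0::'a" r] by auto
  interpret L: sigma_finite_measure "lborel :: 'a measure" by (rule sigma_finite_lborel)
  interpret N: sigma_finite_measure \<nu>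
  proof
    have "(\<Union>n. ball 0 (real n)) = (UNIV :: 'a set)"
      by (auto simp: reals_Archimedean2)
    then show "\<exists>A. countable A \<and> A \<subseteq> sets \<nu> \<and> \<Union> A = space \<nu> \<and> (\<forall>a\<in>A. emeasure \<nu> a \<noteq> \<infinity>)"
      by (intro exI[of _ "range (\<lambda>n. ball (0::'a) (real n))"])
         (auto simp: ball fin simp del: infinity_ennreal_def)
  qed
  interpret P: pair_sigma_finite \<nu> "lborel :: 'a measure" ..
  fix A :: "'a set" assume "A \<in> sets (distr lborel borel T)"
  then have [measurable]: "A \<in> sets borel" by simp
  let ?f = "indicator A :: 'a \<Rightarrow> ennreal" and ?g = "indicator (ball 0 1) :: 'a \<Rightarrow> ennreal"
  have [measurable]: "?f \<in> borel_measurable borel" and gm [measurable]: "?g \<in> borel_measurable borel"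
    by (auto intro!: borel_measurable_indicator)
  have "emeasure \<nu> A * emeasure lborel (ball (0::'a) 1) = (\<integral>\<^sup>+y. ?f y * (\<integral>\<^sup>+x. ?g x \<partial>lborel) \<partial>\<nu>)"
    by (simp add: nn_integral_multc)
  \<comment> \<open>Recentring the ball at \<open>y\<close> is free for \<open>lborel\<close>. After
    Tonelli, the shift of \<open>y\<close> by \<open>x\<close> under \<nu> moves the translation
    onto \<open>?f\<close>, and the two measures trade roles; \<open>?g (- y) = ?g y\<close> because
    the ball is symmetric.\<close>
  also have "\<dots> = (\<integral>\<^sup>+y. ?f y * (\<integral>\<^sup>+x. ?g (- y + x) \<partial>lborel) \<partial>\<nu>)"
    by (simp only: transl[OF gm])
  also have "\<dots> = (\<integral>\<^sup>+y. (\<integral>\<^sup>+x. ?f y * ?g (- y + x) \<partial>lborel) \<partial>\<nu>)"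
    by (simp add: nn_integral_cmult)
  also have "\<dots> = (\<integral>\<^sup>+x. (\<integral>\<^sup>+y. ?f y * ?g (- y + x) \<partial>\<nu>) \<partial>lborel)"
    by (rule P.Fubini'[symmetric]) measurable
  also have "\<dots> = (\<integral>\<^sup>+x. (\<integral>\<^sup>+y. ?f (x + y) * ?g (- y) \<partial>\<nu>) \<partial>lborel)"
  proof (rule nn_integral_cong)
    fix x :: 'a
    show "(\<integral>\<^sup>+y. ?f y * ?g (- y + x) \<partial>\<nu>) = (\<integral>\<^sup>+y. ?f (x + y) * ?g (- y) \<partial>\<nu>)"
      by (subst transl\<nu>[of "\<lambda>y. ?f y * ?g (- y + x)" x, symmetric]) simp_all
  qed
  also have "\<dots> = (\<integral>\<^sup>+y. (\<integral>\<^sup>+x. ?f (x + y) * ?g (- y) \<partial>lborel) \<partial>\<nu>)"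
    by (rule P.Fubini') measurable
  also have "\<dots> = (\<integral>\<^sup>+y. (\<integral>\<^sup>+x. ?f (y + x) \<partial>lborel) * ?g (- y) \<partial>\<nu>)"
    by (simp add: nn_integral_multc add.commute)
  also have "\<dots> = (\<integral>\<^sup>+y. emeasure lborel A * ?g y \<partial>\<nu>)"
  proof (rule nn_integral_cong)
    fix y :: 'a
    have "(\<integral>\<^sup>+x. ?f (y + x) \<partial>lborel) = emeasure lborel A"
      by (subst transl[of ?f y]) simp_all
    then show "(\<integral>\<^sup>+x. ?f (y + x) \<partial>lborel) * ?g (- y) = emeasure lborel A * ?g y"
      by (simp add: indicator_def)
  qed
  also have "\<dots> = emeasure lborel A * emeasure lborel (ball (0::'a) 1)"
    by (simp add: nn_integral_cmult ball)
  finally have "emeasure \<nu> A * emeasure lborel (ball (0::'a) 1) = emeasure lborel A * emeasure lborel (ball (0::'a) 1)" .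
  moreover have "emeasure lborel (ball (0::'a) 1) \<noteq> 0"
    using emeasure_lborel_ball_finite[of "0::'a" 1] open_not_negligible[of "ball (0::'a) 1"]
    by (auto simp: negligible_iff_emeasure0)
  moreover have "emeasure lborel (ball (0::'a) 1) \<noteq> \<top>"
    using emeasure_lborel_ball_finite[of "0::'a" 1] by auto
  ultimately show "emeasure (distr lborel borel T) A = emeasure lborel A"
    by (simp add: \<nu>_def ennreal_mult_cancel_left mult.commute[of _ "emeasure lborel (ball 0 1)"])
qed simp

lemma distr_std_gaussian_orthogonal:
  fixes T :: "'a::euclidean_space \<Rightarrow> 'a"
  assumes T: "orthogonal_transformation T"
  shows "distr std_gaussian borel T = std_gaussian"
proof -
  have lin: "linear T" by (rule orthogonal_transformation_linear[OF T])
  then have m [measurable]: "T \<in> borel \<rightarrow>\<^sub>M borel"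
    by (intro borel_measurable_continuous_onI linear_continuous_on) (simp add: linear_conv_bounded_linear)
  let ?d = "\<lambda>z::'a. ennreal ((1 / sqrt (2 * pi)) ^ DIM('a) * exp (- (norm z)\<^sup>2 / 2))"
  have "density (distr lborel borel T) ?d = distr (density lborel (\<lambda>z. ?d (T z))) borel T"
    by (rule density_distr) auto
  also have "(\<lambda>z. ?d (T z)) = ?d"
    by (simp add: orthogonal_transformation_norm[OF T])
  finally show ?thesis
    unfolding std_gaussian_altdef by (simp add: distr_lborel_orthogonal[OF T])
qed

text \<open>The exponential factor stretches the Gaussian to standard deviation \<open>u\<close>;
  the substitution z = u w then yields \<open>u ^ DIM('a)\<close> from the volume and
  \<open>u ^ k\<close> from the norm. No integrability is assumed, so for \<open>u > 1\<close>
  finiteness passes to an exponentially growing integrand.\<close>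

lemma nn_integral_std_gaussian_scale:
  fixes u :: real
  assumes u: "u > 0"
  shows "(\<integral>\<^sup>+z. ennreal (norm z ^ k * exp ((1 - 1 / u\<^sup>2) * (norm z)\<^sup>2 / 2)) \<partial>(std_gaussian :: 'a::euclidean_space measure))
    = ennreal (u ^ (DIM('a) + k)) * (\<integral>\<^sup>+z. ennreal (norm z ^ k) \<partial>(std_gaussian :: 'a measure))"
proof -
  let ?C = "(1 / sqrt (2 * pi)) ^ DIM('a)"
  have pointwise: "ennreal (?C * exp (- (norm z)\<^sup>2 / 2)) * ennreal (norm z ^ k * exp ((1 - 1 / u\<^sup>2) * (norm z)\<^sup>2 / 2))
      = ennreal (?C * (norm z ^ k * exp (- (norm z / u)\<^sup>2 / 2)))" for z :: 'a
  proof -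
    have "- (norm z)\<^sup>2 / 2 + (1 - 1 / u\<^sup>2) * (norm z)\<^sup>2 / 2 = - (norm z / u)\<^sup>2 / 2"
      by (simp add: field_simps power_divide)
    from arg_cong[OF this, of exp] have e: "exp (- (norm z)\<^sup>2 / 2) * exp ((1 - 1 / u\<^sup>2) * (norm z)\<^sup>2 / 2)
        = exp (- (norm z / u)\<^sup>2 / 2)"
      by (simp only: exp_add)
    show ?thesis
      by (subst ennreal_mult'[symmetric], simp) (simp only: e[symmetric] mult_ac)
  qed
  have "(\<integral>\<^sup>+z. ennreal (norm z ^ k * exp ((1 - 1 / u\<^sup>2) * (norm z)\<^sup>2 / 2)) \<partial>(std_gaussian :: 'a measure))
     = (\<integral>\<^sup>+z. ennreal (?C * (norm z ^ k * exp (- (norm z / u)\<^sup>2 / 2))) \<partial>(lborel :: 'a measure))"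
    unfolding std_gaussian_altdef
    by (subst nn_integral_density) (simp_all only: pointwise, simp_all)
  also have "(lborel :: 'a measure) = density (distr lborel borel (\<lambda>x. 0 + u *\<^sub>R x)) (\<lambda>_. \<bar>u\<bar>^DIM('a))"
    using u by (intro lborel_affine) auto
  also have "(\<integral>\<^sup>+z. ennreal (?C * (norm z ^ k * exp (- (norm z / u)\<^sup>2 / 2))) \<partial>\<dots>)
     = (\<integral>\<^sup>+z. ennreal (u ^ (DIM('a) + k)) * ennreal (?C * (norm z ^ k * exp (- (norm z)\<^sup>2 / 2))) \<partial>(lborel :: 'a measure))"
    apply (subst nn_integral_density, simp, simp)
    apply (subst nn_integral_distr, simp, simp)
    using u by (auto simp: ennreal_mult'[symmetric] power_mult_distrib power_add mult_ac intro!: nn_integral_cong arg_cong[where f=ennreal])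
  also have "\<dots> = ennreal (u ^ (DIM('a) + k)) * (\<integral>\<^sup>+z. ennreal (norm z ^ k) \<partial>(std_gaussian :: 'a measure))"
    unfolding std_gaussian_altdef
    apply (subst nn_integral_cmult, simp)
    apply (subst nn_integral_density)
      apply (auto simp: ennreal_mult'[symmetric] mult_ac)
    done
  finally show ?thesis .
qed

section \<open>Gaussian moments\<close>

lemma integrable_integral_std_gaussian_scale:
  fixes u :: real
  assumes u: "u > 0" and int: "integrable (std_gaussian :: 'a::euclidean_space measure) (\<lambda>z. norm z ^ k)"
  shows "integrable (std_gaussian :: 'a measure) (\<lambda>z. norm z ^ k * exp ((1 - 1 / u\<^sup>2) * (norm z)\<^sup>2 / 2))" (is ?I)
    and "(\<integral>z. norm z ^ k * exp ((1 - 1 / u\<^sup>2) * (norm z)\<^sup>2 / 2) \<partial>(std_gaussian :: 'a measure))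
      = u ^ (DIM('a) + k) * (\<integral>z. norm z ^ k \<partial>(std_gaussian :: 'a measure))" (is ?E)
proof -
  have "(\<integral>\<^sup>+z. ennreal (norm z ^ k * exp ((1 - 1 / u\<^sup>2) * (norm z)\<^sup>2 / 2)) \<partial>(std_gaussian :: 'a measure))
      = ennreal (u ^ (DIM('a) + k) * (\<integral>z. norm z ^ k \<partial>(std_gaussian :: 'a measure)))"
    unfolding nn_integral_std_gaussian_scale[OF u] using u
    by (subst nn_integral_eq_integral[OF int]) (auto simp: ennreal_mult')
  then show ?I ?E
    using u by (auto intro!: integrableI_nonneg integral_eq_nn_integral[THEN trans] mult_nonneg_nonneg integral_nonneg_AE)
qed

text \<open>Scaling with \<open>u = sqrt 2\<close> upgrades integrability of
  \<open>norm z ^ k\<close> to that of \<open>norm z ^ k * exp ((norm z)\<^sup>2 / 4)\<close>, which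
  dominates a multiple of \<open>norm z ^ (k + 2)\<close>. The induction thus advances by two, and
  exponent 1 is reached from exponent 0.\<close>

lemma integrable_norm_power_std_gaussian [simp]:
  "integrable (std_gaussian :: 'a::euclidean_space measure) (\<lambda>z. norm z ^ k)"
proof -
  interpret prob_space "std_gaussian :: 'a measure" by (rule prob_space_std_gaussian)
  have step: "integrable (std_gaussian :: 'a measure) (\<lambda>z. norm z ^ k * exp ((norm z)\<^sup>2 / 4))"
    if "integrable (std_gaussian :: 'a measure) (\<lambda>z. norm z ^ k)" for k
    using integrable_integral_std_gaussian_scale(1)[of "sqrt 2", OF _ that] by simp
  have e: "1 + r\<^sup>2 / 4 \<le> exp (r\<^sup>2 / 4)" for r :: real
    by (rule exp_ge_add_one_self)
  show ?thesis
  proof (induction k rule: induct_nat_012)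
    case 0
    show ?case by simp
  next
    case 1
    have "norm z \<le> exp ((norm z)\<^sup>2 / 4)" for z :: 'a
    proof -
      have "0 \<le> (norm z / 2 - 1)\<^sup>2" by simp
      then have "norm z \<le> 1 + (norm z)\<^sup>2 / 4" by (simp add: power2_eq_square algebra_simps)
      with e[of "norm z"] show ?thesis by linarith
    qed
    moreover have "integrable (std_gaussian :: 'a measure) (\<lambda>z. exp ((norm z)\<^sup>2 / 4))"
      using step[of 0] by simp
    ultimately show ?case
      by (intro Bochner_Integration.integrable_bound[where g = "\<lambda>z. norm z ^ Suc 0" and f = "\<lambda>z. exp ((norm z)\<^sup>2 / 4)"]) auto
  next
    case (ge2 k)
    have "norm z ^ Suc (Suc k) \<le> 4 * (norm z ^ k * exp ((norm z)\<^sup>2 / 4))" for z :: 'a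
    proof -
      have "norm z ^ k * (norm z)\<^sup>2 \<le> norm z ^ k * (4 * exp ((norm z)\<^sup>2 / 4))"
      proof (rule mult_left_mono)
        show "(norm z)\<^sup>2 \<le> 4 * exp ((norm z)\<^sup>2 / 4)" using e[of "norm z"] by linarith
      qed simp
      then show ?thesis by (simp add: power2_eq_square mult_ac)
    qed
    moreover have "integrable (std_gaussian :: 'a measure) (\<lambda>z. 4 * (norm z ^ k * exp ((norm z)\<^sup>2 / 4)))"
      using step[OF ge2(1)] by simp
    ultimately show ?case
      by (intro Bochner_Integration.integrable_bound[where g = "\<lambda>z. norm z ^ Suc (Suc k)" and f = "\<lambda>z. 4 * (norm z ^ k * exp ((norm z)\<^sup>2 / 4))"])
         (auto simp del: power_Suc)
  qed
qed

text \<open>Both sides of the scaling identity touch at $u = 1$ after $e^x$ is replaced by $1 + x$,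
  so the derivatives in $u$ agree there.\<close>

lemma std_gaussian_norm_moment_rec:
  "(\<integral>z. norm z ^ (k + 2) \<partial>(std_gaussian :: 'a::euclidean_space measure))
    = (real DIM('a) + real k) * (\<integral>z. norm z ^ k \<partial>(std_gaussian :: 'a measure))"
proof -
  let ?\<phi> = "\<lambda>k. \<integral>z. norm z ^ k \<partial>(std_gaussian :: 'a measure)"
  define F where "F u = u ^ (DIM('a) + k) * ?\<phi> k - (1 - 1 / u\<^sup>2) / 2 * ?\<phi> (k + 2)" for u :: real
  have F: "F 1 \<le> F u" if u: "u > 0" for u
  proof -
    have "?\<phi> k + (1 - 1 / u\<^sup>2) / 2 * ?\<phi> (k + 2)
        = (\<integral>z. norm z ^ k + (1 - 1 / u\<^sup>2) / 2 * norm z ^ (k + 2) \<partial>(std_gaussian :: 'a measure))"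
      using integrable_norm_power_std_gaussian[of k, where 'a='a]
        integrable_norm_power_std_gaussian[of "k + 2", where 'a='a]
      by (simp del: power_Suc)
    also have "\<dots> \<le> (\<integral>z. norm z ^ k * exp ((1 - 1 / u\<^sup>2) * (norm z)\<^sup>2 / 2) \<partial>(std_gaussian :: 'a measure))"
    proof (rule integral_mono)
      show "integrable std_gaussian (\<lambda>z::'a. norm z ^ k + (1 - 1 / u\<^sup>2) / 2 * norm z ^ (k + 2))"
        using integrable_norm_power_std_gaussian[of k, where 'a='a]
          integrable_norm_power_std_gaussian[of "k + 2", where 'a='a]
        by (simp del: power_Suc)
      show "integrable std_gaussian (\<lambda>z::'a. norm z ^ k * exp ((1 - 1 / u\<^sup>2) * (norm z)\<^sup>2 / 2))"
        by (rule integrable_integral_std_gaussian_scale[OF u]) simp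
      fix z :: 'a
      have "norm z ^ k * (1 + (1 - 1 / u\<^sup>2) * (norm z)\<^sup>2 / 2) \<le> norm z ^ k * exp ((1 - 1 / u\<^sup>2) * (norm z)\<^sup>2 / 2)"
        by (intro mult_left_mono exp_ge_add_one_self) simp
      then show "norm z ^ k + (1 - 1 / u\<^sup>2) / 2 * norm z ^ (k + 2) \<le> norm z ^ k * exp ((1 - 1 / u\<^sup>2) * (norm z)\<^sup>2 / 2)"
        by (simp only: power_add distrib_left mult_1_right) (simp add: mult_ac)
    qed
    also have "\<dots> = u ^ (DIM('a) + k) * ?\<phi> k"
      by (rule integrable_integral_std_gaussian_scale[OF u]) simp
    finally show ?thesis by (simp add: F_def)
  qed
  \<comment> \<open>\<open>F\<close> is minimal at 1 among all positive arguments, hence within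
    distance 1, so this derivative must vanish.\<close>
  have "(F has_real_derivative (real DIM('a) + real k) * ?\<phi> k - ?\<phi> (k + 2)) (at 1)"
    unfolding F_def by (auto intro!: derivative_eq_intros simp: field_simps)
  then have "(real DIM('a) + real k) * ?\<phi> k - ?\<phi> (k + 2) = 0"
    by (rule DERIV_local_min[where d = 1]) (use F in auto)
  then show ?thesis by simp
qed

text \<open>In effect the Cauchy-Schwarz bound of the squared second moment by the product of the
  first and third, where the recursion expresses the third by the first. The weight \<beta> is the
  optimal one in 2 \<beta> r^2 \<le> r^3 + \<beta>^2 r.\<close>

lemma std_gaussian_norm_moment_1_ge:
  "real DIM('a) / sqrt (real DIM('a) + 1) \<le> (\<integral>z. norm z \<partial>(std_gaussian :: 'a::euclidean_space measure))"
proof -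
  interpret prob_space "std_gaussian :: 'a measure" by (rule prob_space_std_gaussian)
  let ?\<phi> = "\<lambda>k. \<integral>z. norm z ^ k \<partial>(std_gaussian :: 'a measure)"
  let ?m = "real DIM('a)"
  define \<beta> where "\<beta> = sqrt (?m + 1)"
  have \<beta>: "\<beta> > 0" "\<beta>\<^sup>2 = ?m + 1" by (simp_all add: \<beta>_def)
  have i: "integrable (std_gaussian :: 'a measure) (\<lambda>z. norm z ^ k)" for k by simp
  have 2: "?\<phi> 2 = ?m" using std_gaussian_norm_moment_rec[of 0, where 'a='a] prob_space by (simp add: numeral_2_eq_2)
  have 3: "?\<phi> 3 = (?m + 1) * ?\<phi> 1"
    using std_gaussian_norm_moment_rec[of 1, where 'a='a] by (simp add: eval_nat_numeral algebra_simps)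
  have "2 * \<beta> * ?\<phi> 2 = (\<integral>z. 2 * \<beta> * norm z ^ 2 \<partial>(std_gaussian :: 'a measure))"
    by simp
  also have "\<dots> \<le> (\<integral>z. norm z ^ 3 + \<beta>\<^sup>2 * norm z ^ 1 \<partial>(std_gaussian :: 'a measure))"
  proof (rule integral_mono)
    fix z :: 'a
    have "0 \<le> norm z * (norm z - \<beta>)\<^sup>2" by simp
    then show "2 * \<beta> * norm z ^ 2 \<le> norm z ^ 3 + \<beta>\<^sup>2 * norm z ^ 1"
      by (simp add: power2_eq_square power3_eq_cube algebra_simps)
  qed (use i[of 1] i[of 2] i[of 3] in simp_all)
  also have "\<dots> = ?\<phi> 3 + \<beta>\<^sup>2 * ?\<phi> 1"
    using i[of 1] i[of 3] by simp
  finally have "\<beta> * ?m \<le> \<beta> * (\<beta> * ?\<phi> 1)"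
    unfolding 2 3 \<beta>(2)[symmetric] by (simp add: power2_eq_square algebra_simps)
  then have "?m / \<beta> \<le> ?\<phi> 1"
    using \<beta> by (simp add: field_simps)
  then show ?thesis by (simp only: \<beta>_def power_one_right)
qed

section \<open>Fourth moments forced by orthogonal symmetry\<close>

lemma integral_std_gaussian_orthogonal:
  fixes f :: "'a::euclidean_space \<Rightarrow> real" and T :: "'a \<Rightarrow> 'a"
  assumes T: "orthogonal_transformation T" and [measurable]: "f \<in> borel_measurable borel"
  shows "(\<integral>z. f (T z) \<partial>std_gaussian) = (\<integral>z. f z \<partial>std_gaussian)"
proof -
  have [measurable]: "T \<in> borel \<rightarrow>\<^sub>M borel"
    using orthogonal_transformation_linear[OF T]
    by (intro borel_measurable_continuous_onI linear_continuous_on) (simp add: linear_conv_bounded_linear)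
  show ?thesis
    by (subst (2) distr_std_gaussian_orthogonal[OF T, symmetric]) (simp add: integral_distr)
qed

text \<open>The divisor \<open>norm z ^ 3\<close> makes the integrand homogeneous of degree one,
  matching the quartic term of the trace bound when x is proportional to the norm.\<close>

definition quartic_moment :: "'a::euclidean_space \<Rightarrow> 'a \<Rightarrow> 'a \<Rightarrow> 'a \<Rightarrow> real" where
  "quartic_moment a b c d =
     (\<integral>z. (z \<bullet> a) * (z \<bullet> b) * (z \<bullet> c) * (z \<bullet> d) / norm z ^ 3 \<partial>std_gaussian)"

lemma integrable_quartic:
  fixes a b c d :: "'a::euclidean_space"
  assumes "norm a = 1" "norm b = 1" "norm c = 1" "norm d = 1"
  shows "integrable std_gaussian (\<lambda>z. (z \<bullet> a) * (z \<bullet> b) * (z \<bullet> c) * (z \<bullet> d) / norm z ^ 3)"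
proof (rule Bochner_Integration.integrable_bound)
  show "integrable (std_gaussian :: 'a measure) norm"
    using integrable_norm_power_std_gaussian[of 1, where 'a='a] by simp
  have "\<bar>z \<bullet> a\<bar> * \<bar>z \<bullet> b\<bar> * \<bar>z \<bullet> c\<bar> * \<bar>z \<bullet> d\<bar> \<le> norm z * norm z * norm z * norm z" for z
    using Cauchy_Schwarz_ineq2[of z a] Cauchy_Schwarz_ineq2[of z b]
      Cauchy_Schwarz_ineq2[of z c] Cauchy_Schwarz_ineq2[of z d] assms
    by (intro mult_mono) auto
  \<comment> \<open>At \<open>z = 0\<close> the quotient is 0 by the convention on division, so the
    bound holds everywhere.\<close>
  then have "\<bar>z \<bullet> a\<bar> * \<bar>z \<bullet> b\<bar> * \<bar>z \<bullet> c\<bar> * \<bar>z \<bullet> d\<bar> / norm z ^ 3 \<le> norm z" for z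
    by (cases "z = 0") (auto simp: pos_divide_le_eq power3_eq_cube mult.assoc)
  then show "AE z in std_gaussian. norm ((z \<bullet> a) * (z \<bullet> b) * (z \<bullet> c) * (z \<bullet> d) / norm z ^ 3) \<le> norm (norm z)"
    by (intro AE_I2) (simp add: abs_mult)
qed simp

text \<open>Reflection in the hyperplane orthogonal to \<open>a\<close> reverses the sign of exactly
  one of the four factors and preserves the norm.\<close>

lemma quartic_moment_flip:
  fixes a b c d :: "'a::euclidean_space"
  assumes "a \<in> Basis" "b \<in> Basis" "c \<in> Basis" "d \<in> Basis" "a \<noteq> b" "a \<noteq> c" "a \<noteq> d"
  shows "quartic_moment a b c d = 0"
proof -
  define T where "T z = z - (2 * (z \<bullet> a)) *\<^sub>R a" for z
  have o: "orthogonal_transformation T"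
    unfolding orthogonal_transformation_def
  proof (intro conjI allI)
    show "linear T" unfolding T_def by (auto intro!: linearI simp: algebra_simps)
    show "T v \<bullet> T w = v \<bullet> w" for v w
      using assms(1) inner_commute[of a v] inner_commute[of a w]
      by (simp add: T_def algebra_simps inner_Basis)
  qed
  have n: "norm (T z) = norm z" for z by (rule orthogonal_transformation_norm[OF o])
  have T: "T z \<bullet> a = - (z \<bullet> a)" "T z \<bullet> b = z \<bullet> b" "T z \<bullet> c = z \<bullet> c" "T z \<bullet> d = z \<bullet> d" for z
    using assms by (simp_all add: T_def algebra_simps inner_Basis)
  have "quartic_moment a b c d = - quartic_moment a b c d"
    using integral_std_gaussian_orthogonal[OF o, of "\<lambda>z. (z \<bullet> a) * (z \<bullet> b) * (z \<bullet> c) * (z \<bullet> d) / norm z ^ 3"]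
    by (simp add: T n quartic_moment_def)
  then show ?thesis by simp
qed

lemma quartic_moment_commute: "quartic_moment a b c d = quartic_moment a c b d"
  by (simp add: quartic_moment_def mult_ac)

text \<open>Rotation by 45 degrees in the plane of \<open>a\<close> and \<open>b\<close>.\<close>

lemma quartic_moment_rotate:
  fixes a b :: "'a::euclidean_space"
  assumes ab: "a \<in> Basis" "b \<in> Basis" "a \<noteq> b"
  shows "quartic_moment a a a a = 3 * quartic_moment a a b b"
    and "quartic_moment b b b b = quartic_moment a a a a"
proof -
  define s :: real where "s = 1 / sqrt 2"
  have s2: "s * s = 1 / 2" by (simp add: s_def)
  have s2': "s * (s * x) = x / 2" for x by (simp add: s_def)
  \<comment> \<open>\<open>T\<close> replaces the coordinates x, y along \<open>a\<close>,
    \<open>b\<close> by s (x + y), s (x - y) and fixes all others.\<close>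
  define T where "T z = z + (s * (z \<bullet> a + z \<bullet> b) - z \<bullet> a) *\<^sub>R a + (s * (z \<bullet> a - z \<bullet> b) - z \<bullet> b) *\<^sub>R b" for z
  have o: "orthogonal_transformation T"
    unfolding orthogonal_transformation_def
  proof (intro conjI allI)
    show "linear T" unfolding T_def by (auto intro!: linearI simp: algebra_simps)
    show "T v \<bullet> T w = v \<bullet> w" for v w
      using ab inner_commute[of a v] inner_commute[of a w] inner_commute[of b v] inner_commute[of b w]
      by (simp add: T_def algebra_simps inner_Basis s2')
  qed
  have n: "norm (T z) = norm z" for z by (rule orthogonal_transformation_norm[OF o])
  have T: "T z \<bullet> a = s * (z \<bullet> a + z \<bullet> b)" "T z \<bullet> b = s * (z \<bullet> a - z \<bullet> b)" for z
    using ab by (simp_all add: T_def algebra_simps inner_Basis)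
  have s4: "s * x * (s * y) * (s * z) * (s * w) = x * y * z * w / 4" for x y z w
  proof -
    have "s * x * (s * y) * (s * z) * (s * w) = (s * s) * (s * s) * (x * y * z * w)" by (simp add: algebra_simps)
    then show ?thesis by (simp add: s2)
  qed
  define Q where "Q c d e f z = (z \<bullet> c) * (z \<bullet> d) * (z \<bullet> e) * (z \<bullet> f) / norm z ^ 3" for c d e f z :: 'a
  have i: "integrable std_gaussian (Q c d e f)" if "c \<in> {a,b}" "d \<in> {a,b}" "e \<in> {a,b}" "f \<in> {a,b}" for c d e f
    unfolding Q_def using that ab by (intro integrable_quartic) auto
  have Q: "quartic_moment c d e f = (\<integral>z. Q c d e f z \<partial>std_gaussian)" for c d e f
    by (simp add: quartic_moment_def Q_def)
  have QT: "quartic_moment c d e f = (\<integral>z. Q c d e f (T z) \<partial>std_gaussian)" for c d e f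
    unfolding Q by (rule integral_std_gaussian_orthogonal[OF o, symmetric]) (simp add: Q_def[abs_def])
  \<comment> \<open>Invariance under \<open>T\<close> turns x^2 y^2 into (x^2 - y^2)^2 / 4.\<close>
  have 1: "quartic_moment a a b b = (quartic_moment a a a a + quartic_moment b b b b - 2 * quartic_moment a a b b) / 4"
  proof -
    have "Q a a b b (T z) = (Q a a a a z + Q b b b b z - 2 * Q a a b b z) / 4" for z
      unfolding Q_def n T s4 by (simp add: add_divide_distrib diff_divide_distrib algebra_simps)
    then have "quartic_moment a a b b = (\<integral>z. (Q a a a a z + Q b b b b z - 2 * Q a a b b z) / 4 \<partial>std_gaussian)"
      unfolding QT[of a a b b] by presburger
    also have "\<dots> = (quartic_moment a a a a + quartic_moment b b b b - 2 * quartic_moment a a b b) / 4"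
      unfolding Q using i by simp
    finally show ?thesis .
  qed
  \<comment> \<open>Under \<open>T\<close> the difference x^4 - y^4 becomes 2 x^3 y + 2 x y^3, and
    both terms vanish by reflection.\<close>
  have 2: "quartic_moment a a a a - quartic_moment b b b b = 0"
  proof -
    have "Q a a a a (T z) - Q b b b b (T z) = 2 * Q b a a a z + 2 * Q a b b b z" for z
      unfolding Q_def n T s4 by (simp add: add_divide_distrib diff_divide_distrib algebra_simps)
    moreover have "quartic_moment a a a a - quartic_moment b b b b = (\<integral>z. Q a a a a z - Q b b b b z \<partial>std_gaussian)"
      unfolding Q using i by simp
    moreover have "(\<integral>z. Q a a a a z - Q b b b b z \<partial>std_gaussian) = (\<integral>z. Q a a a a (T z) - Q b b b b (T z) \<partial>std_gaussian)"
      using integral_std_gaussian_orthogonal[OF o, of "\<lambda>z. Q a a a a z - Q b b b b z"] by (simp add: Q_def)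
    ultimately have "quartic_moment a a a a - quartic_moment b b b b
        = (\<integral>z. 2 * Q b a a a z + 2 * Q a b b b z \<partial>std_gaussian)"
      by simp
    also have "\<dots> = 2 * quartic_moment b a a a + 2 * quartic_moment a b b b"
      unfolding Q using i by simp
    also have "\<dots> = 0"
      using ab quartic_moment_flip[of b a a a] quartic_moment_flip[of a b b b] by simp
    finally show ?thesis .
  qed
  from 1 2 show "quartic_moment a a a a = 3 * quartic_moment a a b b"
    and "quartic_moment b b b b = quartic_moment a a a a" by auto
qed

text \<open>By symmetry all these moments are q or 3q. Their sum over all pairs of basis vectors is
  the mean of norm^4 / norm^3, which fixes q: there are m^2 pairs, of which the m diagonal ones
  count 2q extra, giving m (m + 2) q.\<close>

lemma quartic_moment_eq:
  fixes a b :: "'a::euclidean_space"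
  assumes ab: "a \<in> Basis" "b \<in> Basis"
  shows "quartic_moment a a b b = (if a = b then 3 else 1) *
    (\<integral>z. norm z \<partial>(std_gaussian :: 'a measure)) / (real DIM('a) * (real DIM('a) + 2))"
proof -
  let ?Q = "\<lambda>a b z. (z \<bullet> a) * (z \<bullet> a) * (z \<bullet> b) * (z \<bullet> b) / norm z ^ 3"
  let ?m = "real DIM('a)"
  define q where "q = quartic_moment a a a a / 3"
  have q: "quartic_moment c c d d = (if c = d then 3 * q else q)" if cd: "c \<in> Basis" "d \<in> Basis" for c d :: 'a
  proof -
    have *: "quartic_moment c c c c = 3 * q" if "c \<in> Basis" for c :: 'a
      using quartic_moment_rotate(2)[of a c] that ab by (cases "a = c") (auto simp: q_def)
    show ?thesis
      using *[OF cd(1)] quartic_moment_rotate(1)[of c d] cd by auto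
  qed
  have "(\<integral>z. norm z \<partial>(std_gaussian :: 'a measure)) = (\<integral>z. (\<Sum>c\<in>Basis. \<Sum>d\<in>Basis. ?Q c d z) \<partial>(std_gaussian :: 'a measure))"
  proof (rule Bochner_Integration.integral_cong)
    fix z :: 'a
    have "(\<Sum>c\<in>Basis. \<Sum>d\<in>Basis. ?Q c d z) = (\<Sum>c\<in>Basis. (z \<bullet> c)\<^sup>2) * (\<Sum>d\<in>Basis. (z \<bullet> d)\<^sup>2) / norm z ^ 3"
      by (simp add: sum_product sum_divide_distrib power2_eq_square mult_ac)
    also have "\<dots> = norm z"
      unfolding norm_power2_Basis[symmetric] by (cases "z = 0") (simp_all add: eval_nat_numeral)
    finally show "norm z = (\<Sum>c\<in>Basis. \<Sum>d\<in>Basis. ?Q c d z)" ..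
  qed simp
  also have "\<dots> = (\<Sum>c\<in>Basis. \<Sum>d\<in>(Basis::'a set). quartic_moment c c d d)"
    unfolding quartic_moment_def
    by (subst Bochner_Integration.integral_sum, (intro Bochner_Integration.integrable_sum integrable_quartic; simp),
        intro sum.cong refl, subst Bochner_Integration.integral_sum, (intro integrable_quartic; simp), simp)
  also have "\<dots> = (\<Sum>c\<in>(Basis::'a set). \<Sum>d\<in>(Basis::'a set). q + (if c = d then 2 * q else 0))"
    by (intro sum.cong refl) (simp add: q)
  also have "\<dots> = ?m * (?m + 2) * q"
    by (simp add: sum.distrib algebra_simps)
  finally have "q = (\<integral>z. norm z \<partial>(std_gaussian :: 'a measure)) / (?m * (?m + 2))"
    by (subst eq_divide_eq) (simp add: mult.commute)
  with q[OF ab] show ?thesis by simp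
qed

section \<open>Orthogonal matrices and traces\<close>

lemma inner_matrix: "inner (A :: real^'n^'m) B = (\<Sum>i\<in>UNIV. \<Sum>j\<in>UNIV. A $ i $ j * B $ i $ j)"
  by (simp add: inner_vec_def)

lemma inner_matrix_trace: "inner (A :: real^'n^'m) B = trace (transpose A ** B)"
  unfolding inner_matrix trace_def by (simp add: matrix_matrix_mult_def transpose_def) (rule sum.swap)

lemma inner_orthogonal_left:
  assumes "orthogonal_matrix (V :: real^'n^'n)"
  shows "inner (V ** A) (V ** B) = inner A B"
proof -
  have "transpose (V ** A) ** (V ** B) = transpose A ** (transpose V ** V) ** B"
    by (simp add: matrix_transpose_mul matrix_mul_assoc)
  then show ?thesis
    using assms by (simp add: inner_matrix_trace orthogonal_matrix)
qed

lemma inner_orthogonal_right: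
  assumes "orthogonal_matrix (V :: real^'n^'n)"
  shows "inner (A ** V) (B ** V) = inner A B"
proof -
  have "trace (transpose (A ** V) ** (B ** V)) = trace ((transpose A ** B ** V) ** transpose V)"
    by (subst trace_mul_sym) (simp add: matrix_transpose_mul matrix_mul_assoc)
  also have "(transpose A ** B ** V) ** transpose V = transpose A ** B ** (V ** transpose V)"
    by (simp add: matrix_mul_assoc)
  finally show ?thesis
    using assms by (simp add: inner_matrix_trace orthogonal_matrix_def)
qed

lemma orthogonal_transformation_matrix_mul:
  assumes "orthogonal_matrix (V :: real^'n^'n)" "orthogonal_matrix W"
  shows "orthogonal_transformation (\<lambda>X. V ** X ** W)"
  unfolding orthogonal_transformation_def
  by (auto simp: inner_orthogonal_left inner_orthogonal_right assms intro!: linearI)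
     (simp_all add: matrix_matrix_mult_def vec_eq_iff algebra_simps sum.distrib sum_distrib_left sum_distrib_right)

lemma norm_orthogonal_right:
  "orthogonal_matrix (V :: real^'n^'n) \<Longrightarrow> norm (A ** V) = norm A"
  by (simp add: norm_eq_sqrt_inner inner_orthogonal_right)

lemma compact_orthogonal: "compact {Q :: real^'n^'n. orthogonal_matrix Q}"
proof -
  have "norm Q \<le> sqrt (real CARD('n))" if "orthogonal_matrix Q" for Q :: "real^'n^'n"
    using that by (simp add: norm_eq_sqrt_inner inner_matrix_trace orthogonal_matrix trace_I)
  then have b: "bounded {Q :: real^'n^'n. orthogonal_matrix Q}"
    by (auto simp: bounded_iff)
  have "{Q :: real^'n^'n. orthogonal_matrix Q}
      = {Q. \<forall>i j. (\<Sum>k\<in>UNIV. Q $ k $ i * Q $ k $ j) = (mat 1 :: real^'n^'n) $ i $ j}"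
    by (auto simp: orthogonal_matrix vec_eq_iff matrix_matrix_mult_def transpose_def)
  moreover have "closed {Q :: real^'n^'n. \<forall>i j. (\<Sum>k\<in>UNIV. Q $ k $ i * Q $ k $ j) = (mat 1 :: real^'n^'n) $ i $ j}"
    by (intro closed_Collect_all closed_Collect_eq continuous_intros)
  ultimately show ?thesis using b by (simp add: compact_eq_bounded_closed)
qed

section \<open>Polar decomposition and a lower bound for the trace\<close>

lemma trace_mul_matrix:
  "trace (P ** matrix f) = (\<Sum>k\<in>UNIV. (P *v f (axis k 1)) $ k)" for P :: "real^'n^'n"
  by (simp add: trace_def matrix_matrix_mult_def matrix_def matrix_vector_mult_def)

lemma mat_mult_axis: "((P :: real^'n^'n) *v axis j 1) $ k = P $ k $ j"
  by (simp add: matrix_vector_mult_basis column_def)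

text \<open>The orthogonal factor of the polar decomposition maximizes the trace. Comparing the maximizer
  with its rotations in coordinate planes gives symmetry, with its reflections positivity.\<close>

lemma polar_factor:
  fixes G :: "real^'n^'n"
  obtains W where "orthogonal_matrix W" "transpose (G ** W) = G ** W"
    "\<And>v. 0 \<le> v \<bullet> ((G ** W) *v v)"
proof -
  have "continuous_on {Q. orthogonal_matrix Q} (\<lambda>W. trace (G ** W))"
    unfolding trace_def matrix_matrix_mult_def by (simp, intro continuous_intros)
  then obtain W where W: "orthogonal_matrix W"
    and max: "\<And>U. orthogonal_matrix U \<Longrightarrow> trace (G ** U) \<le> trace (G ** W)"
    using continuous_attains_sup[OF compact_orthogonal, of "\<lambda>W. trace (G ** W)"] orthogonal_matrix_id by blast
  define P where "P = G ** W"
  \<comment> \<open>Every orthogonal map \<open>f\<close> yields the competitor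
    \<open>W ** matrix f\<close>, so \<open>P\<close> followed on the right by \<open>f\<close>
    cannot have larger trace than \<open>P\<close>.\<close>
  have mx: "(\<Sum>k\<in>UNIV. (P *v f (axis k 1)) $ k) \<le> trace P"
    if "orthogonal_transformation f" for f :: "real^'n \<Rightarrow> real^'n"
  proof -
    have "orthogonal_matrix (matrix f)"
      using that by (simp add: orthogonal_transformation_matrix)
    then have "orthogonal_matrix (W ** matrix f)" using W by (rule orthogonal_matrix_mul[rotated])
    then have "trace (P ** matrix f) \<le> trace P"
      using max[of "W ** matrix f"] by (simp add: P_def matrix_mul_assoc)
    then show ?thesis by (simp only: trace_mul_matrix)
  qed
  have tr: "trace P = (\<Sum>k\<in>UNIV. (P *v axis k 1) $ k)"
    by (simp add: trace_def mat_mult_axis)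
  have psd: "0 \<le> v \<bullet> (P *v v)" for v
  proof (cases "v = 0")
    case False
    then have vv: "v \<bullet> v > 0" by simp
    \<comment> \<open>The reflection along \<open>v\<close> lowers the trace by 2 (v, Pv) / (v, v),
      which maximality forces to be nonnegative.\<close>
    define f where "f x = x - (2 * (v \<bullet> x) / (v \<bullet> v)) *\<^sub>R v" for x
    have "orthogonal_transformation f"
      unfolding orthogonal_transformation_def
    proof (intro conjI allI)
      show "linear f" unfolding f_def
        by (auto intro!: linearI simp: algebra_simps add_divide_distrib)
      show "f x \<bullet> f y = x \<bullet> y" for x y
        using vv inner_commute[of v x] by (simp add: f_def algebra_simps)
    qed
    from mx[OF this] have "(\<Sum>k\<in>UNIV. (P *v f (axis k 1)) $ k) \<le> trace P" .
    also have "(\<Sum>k\<in>UNIV. (P *v f (axis k 1)) $ k) = trace P - 2 / (v \<bullet> v) * (v \<bullet> (P *v v))"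
      by (simp add: f_def tr matrix_vector_mult_diff_distrib matrix_vector_mult_scaleR inner_axis
          sum_subtractf sum_distrib_left inner_vec_def[of v "P *v v"] mult_ac)
    finally have "0 \<le> 2 / (v \<bullet> v) * (v \<bullet> (P *v v))" by simp
    then show ?thesis using vv by (subst (asm) zero_le_mult_iff) (auto simp del: inner_gt_zero_iff)
  qed simp
  have sym: "P $ i $ j = P $ j $ i" if ij: "i \<noteq> j" for i j
  proof -
    define a where "a = P $ i $ i + P $ j $ j"
    define b where "b = P $ i $ j - P $ j $ i"
    have *: "(c - 1) * a + s * b \<le> 0" if cs: "c\<^sup>2 + s\<^sup>2 = 1" for c s
    proof -
      \<comment> \<open>Rotation in the plane of the coordinates \<open>i\<close> and
        \<open>j\<close> with cosine \<open>c\<close> and sine \<open>s\<close>.\<close>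
      define f where "f x = x + ((c - 1) * (x $ i) - s * (x $ j)) *\<^sub>R axis i 1
         + (s * (x $ i) + (c - 1) * (x $ j)) *\<^sub>R axis j 1" for x :: "real^'n"
      have "orthogonal_transformation f"
        unfolding orthogonal_transformation_def
      proof (intro conjI allI)
        show "linear f" unfolding f_def
          by (auto intro!: linearI simp: algebra_simps)
        have cs': "c * (c * z) = z - s * (s * z)" for z
        proof -
          have "(c\<^sup>2 + s\<^sup>2) * z = z" by (simp add: cs)
          then show ?thesis by (simp add: power2_eq_square algebra_simps)
        qed
        have ax: "axis i (1::real) $ j = 0" "axis j (1::real) $ i = 0"
          using ij by (simp_all add: axis_def)
        show "f x \<bullet> f y = x \<bullet> y" for x y
          using ij by (simp add: f_def algebra_simps ax inner_axis_axis inner_axis inner_axis' cs')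
      qed
      have axk: "axis k (1::real) $ l = (if l = k then 1 else 0)" for k l :: 'n
        by (simp add: axis_def)
      from mx[OF \<open>orthogonal_transformation f\<close>] have "(\<Sum>k\<in>UNIV. (P *v f (axis k 1)) $ k) \<le> trace P" .
      also have "(\<Sum>k\<in>UNIV. (P *v f (axis k 1)) $ k) =
          (\<Sum>k\<in>UNIV. (P *v axis k 1) $ k + ((if k = i then (c - 1) * (P $ k $ i) + s * (P $ k $ j) else 0) +
             (if k = j then (c - 1) * (P $ k $ j) - s * (P $ k $ i) else 0)))"
        using ij by (intro sum.cong refl)
          (auto simp: f_def matrix_vector_right_distrib matrix_vector_mult_scaleR mat_mult_axis axk)
      also have "\<dots> = trace P + (((c - 1) * (P $ i $ i) + s * (P $ i $ j)) + ((c - 1) * (P $ j $ j) - s * (P $ j $ i)))"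
        unfolding sum.distrib tr by simp
      finally show ?thesis by (simp add: a_def b_def algebra_simps)
    qed
    \<comment> \<open>The rational parametrization of the circle by (1 - t^2) / (1 + t^2) and 2t /
      (1 + t^2) removes the constraint on \<open>c\<close> and \<open>s\<close>.\<close>
    have **: "t * b \<le> t\<^sup>2 * a" for t
    proof -
      have p: "1 + t\<^sup>2 > 0" by (simp add: add_pos_nonneg)
      have "((1 - t\<^sup>2) / (1 + t\<^sup>2))\<^sup>2 + (2 * t / (1 + t\<^sup>2))\<^sup>2 = ((1 - t\<^sup>2)\<^sup>2 + (2 * t)\<^sup>2) / (1 + t\<^sup>2)\<^sup>2"
        by (simp add: power_divide add_divide_distrib)
      also have "(1 - t\<^sup>2)\<^sup>2 + (2 * t)\<^sup>2 = (1 + t\<^sup>2)\<^sup>2"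
        by (simp add: power2_eq_square algebra_simps)
      finally have "((1 - t\<^sup>2) / (1 + t\<^sup>2))\<^sup>2 + (2 * t / (1 + t\<^sup>2))\<^sup>2 = 1"
        using p by simp
      from *[OF this] have "(((1 - t\<^sup>2) / (1 + t\<^sup>2) - 1) * a + 2 * t / (1 + t\<^sup>2) * b) * (1 + t\<^sup>2) \<le> 0"
        using p by (intro mult_nonpos_nonneg) auto
      also have "(((1 - t\<^sup>2) / (1 + t\<^sup>2) - 1) * a + 2 * t / (1 + t\<^sup>2) * b) * (1 + t\<^sup>2) = 2 * (t * b - t\<^sup>2 * a)"
      proof -
        have "(1 - t\<^sup>2) / (1 + t\<^sup>2) - 1 = (- 2 * t\<^sup>2) / (1 + t\<^sup>2)"
          using p by (simp add: field_simps)
        then have "((1 - t\<^sup>2) / (1 + t\<^sup>2) - 1) * a + 2 * t / (1 + t\<^sup>2) * b = (2 * (t * b - t\<^sup>2 * a)) / (1 + t\<^sup>2)"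
          by (simp only:) (simp add: diff_divide_distrib algebra_simps)
        then show ?thesis using p by simp
      qed
      finally show ?thesis by simp
    qed
    have "b = 0"
    proof (rule ccontr)
      assume b: "b \<noteq> 0"
      \<comment> \<open>For small \<open>t\<close> the linear term outweighs the quadratic one. This
        \<open>t\<close> has the sign of \<open>b\<close> and is small enough relative to
        \<open>a\<close> to give a contradiction.\<close>
      define t where "t = b / (1 + \<bar>a\<bar>)"
      have p: "1 + \<bar>a\<bar> > 0" by simp
      have "t * b \<le> t\<^sup>2 * a" by (rule **)
      also have "\<dots> \<le> t\<^sup>2 * \<bar>a\<bar>" by (intro mult_left_mono) auto
      also have "\<dots> = t * (t * \<bar>a\<bar>)" by (simp add: power2_eq_square)
      also have "t * b = t * (t * (1 + \<bar>a\<bar>))" using p by (simp add: t_def)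
      finally have "t\<^sup>2 \<le> 0" by (simp add: power2_eq_square algebra_simps)
      then have "t = 0" by simp
      then show False using b p by (simp add: t_def)
    qed
    then show ?thesis by (simp add: b_def)
  qed
  have "transpose P = P"
    unfolding transpose_def vec_eq_iff by (auto, metis sym)
  then show ?thesis using that[OF W] psd by (simp add: P_def)
qed

lemma trace_ge_of_psd:
  fixes P :: "real^'n^'n"
  assumes sym: "transpose P = P" and psd: "\<And>v. 0 \<le> v \<bullet> (P *v v)" and x: "x > 0"
  shows "3 / (2 * x) * (norm P)\<^sup>2 - (norm (P ** P))\<^sup>2 / (2 * x ^ 3) \<le> trace P"
proof -
  define S where "S = P - x *\<^sub>R mat 1"
  have PS: "P ** S = P ** P - x *\<^sub>R P"
  proof -
    have "P ** S + P ** (x *\<^sub>R mat 1) = P ** P"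
      by (simp add: S_def flip: matrix_add_ldistrib)
    moreover have "P ** (x *\<^sub>R mat 1) = x *\<^sub>R P"
      by (simp add: vec_eq_iff matrix_matrix_mult_def mat_def if_distrib cong: if_cong)
    ultimately show ?thesis by (simp add: algebra_simps)
  qed
  have "inner S (P ** S) = (\<Sum>k\<in>UNIV. column k S \<bullet> (P *v column k S))"
    unfolding inner_matrix by (subst sum.swap) (simp add: inner_vec_def column_def matrix_vector_mult_def matrix_matrix_mult_def)
  then have 1: "0 \<le> inner S (P ** S)" by (simp add: psd sum_nonneg)
  have I: "inner (mat 1) (P ** P) = inner P P" "inner (mat 1) P = trace P" "inner P (mat 1) = trace P"
    by (simp_all add: inner_matrix_trace sym)
  have "0 \<le> inner (P ** S) (P ** S) + 2 * x * inner S (P ** S)"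
    using 1 x by simp
  also have "\<dots> = inner (P ** P) (P ** P) - 3 * x\<^sup>2 * inner P P + 2 * x ^ 3 * trace P"
    unfolding PS unfolding S_def
    by (simp add: inner_diff_left inner_diff_right I inner_commute[of "P ** P" P] power2_eq_square power3_eq_cube algebra_simps)
  finally have "3 * x\<^sup>2 * (norm P)\<^sup>2 - (norm (P ** P))\<^sup>2 \<le> trace P * (2 * x ^ 3)"
    by (simp add: power2_norm_eq_inner algebra_simps)
  then have "(3 * x\<^sup>2 * (norm P)\<^sup>2 - (norm (P ** P))\<^sup>2) / (2 * x ^ 3) \<le> trace P"
    using x by (subst pos_divide_le_eq) auto
  also have "(3 * x\<^sup>2 * (norm P)\<^sup>2 - (norm (P ** P))\<^sup>2) / (2 * x ^ 3) = 3 / (2 * x) * (norm P)\<^sup>2 - (norm (P ** P))\<^sup>2 / (2 * x ^ 3)"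
    using x by (simp add: diff_divide_distrib power2_eq_square power3_eq_cube)
  finally show ?thesis .
qed

text \<open>The previous bound at x = \<open>c * norm G\<close>. The left-hand side is free of
  \<open>W\<close>, which spares any measurable selection later.\<close>

lemma exists_orthogonal_trace_ge:
  fixes G :: "real^'n^'n"
  assumes c: "c > 0"
  obtains W where "orthogonal_matrix W"
    "3 / (2 * c) * norm G - (norm (G ** transpose G))\<^sup>2 / norm G ^ 3 / (2 * c ^ 3) \<le> trace (G ** W)"
proof -
  obtain W where W: "orthogonal_matrix W" and P: "transpose (G ** W) = G ** W"
    "\<And>v. 0 \<le> v \<bullet> ((G ** W) *v v)"
    using polar_factor[of G] by blast
  have "(G ** W) ** (G ** W) = (G ** W) ** transpose (G ** W)" by (simp add: P)
  also have "\<dots> = G ** (W ** transpose W) ** transpose G"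
    by (simp add: matrix_transpose_mul matrix_mul_assoc)
  finally have PP: "(G ** W) ** (G ** W) = G ** transpose G"
    using W by (simp add: orthogonal_matrix_def)
  have n: "norm (G ** W) = norm G" by (rule norm_orthogonal_right[OF W])
  have "0 \<le> (G ** W) $ k $ k" for k
    using P(2)[of "axis k 1"] by (simp add: inner_axis' mat_mult_axis)
  then have 0: "0 \<le> trace (G ** W)" by (simp add: trace_def sum_nonneg)
  have "3 / (2 * c) * norm G - (norm (G ** transpose G))\<^sup>2 / norm G ^ 3 / (2 * c ^ 3) \<le> trace (G ** W)"
  \<comment> \<open>At \<open>G = 0\<close> this x is not positive; the bound is then 0, by division
    by zero in the second term.\<close>
  proof (cases "G = 0")
    case False
    then have "c * norm G > 0" using c by simp
    from trace_ge_of_psd[OF P this] False c show ?thesis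
      unfolding PP n by (simp add: power2_eq_square power_mult_distrib mult_ac)
  qed (use 0 in simp)
  with W show ?thesis by (rule that)
qed

text \<open>These are the signed permutation matrices; integrality of the entries makes closure
  under products immediate.\<close>

definition integer_orthogonal :: "(real^'n^'n) set" where
  "integer_orthogonal = {V. orthogonal_matrix V \<and> (\<forall>i j. V $ i $ j \<in> \<int>)}"

lemma finite_integer_orthogonal: "finite (integer_orthogonal :: (real^'n^'n) set)"
proof (rule finite_subset)
  let ?F = "(UNIV :: ('n \<times> 'n) set) \<rightarrow>\<^sub>E {-1, 0, 1 :: real}"
  show "finite ((\<lambda>f. \<chi> i j. f (i, j)) ` ?F :: (real^'n^'n) set)"
    by (intro finite_imageI finite_PiE) auto
  show "integer_orthogonal \<subseteq> ((\<lambda>f. \<chi> i j. f (i, j)) ` ?F :: (real^'n^'n) set)"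
  proof
    fix V :: "real^'n^'n" assume V: "V \<in> integer_orthogonal"
    have "V $ i $ j \<in> {-1, 0, 1}" for i j
    proof -
      have "V $ i $ j \<in> \<int>" using V by (simp add: integer_orthogonal_def)
      then obtain z where z: "V $ i $ j = of_int z" by (rule Ints_cases)
      \<comment> \<open>Rows are unit vectors, so an integer entry can only be -1, 0 or 1.\<close>
      have "\<bar>V $ i $ j\<bar> \<le> norm (row i V)"
        using component_le_norm_cart[of "row i V" j] by (simp add: row_def)
      also have "\<dots> = 1"
        using V by (simp add: integer_orthogonal_def orthogonal_matrix_orthonormal_rows)
      finally have "\<bar>z\<bar> \<le> 1" by (simp add: z)
      then have "z = -1 \<or> z = 0 \<or> z = 1" by linarith
      then show ?thesis by (auto simp: z)
    qed
    then show "V \<in> (\<lambda>f. \<chi> i j. f (i, j)) ` ?F"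
      by (intro image_eqI[of _ _ "\<lambda>(i, j). V $ i $ j"]) (auto simp: vec_eq_iff)
  qed
qed

lemma mat_1_integer_orthogonal: "mat 1 \<in> integer_orthogonal"
  using orthogonal_matrix_id by (auto simp: integer_orthogonal_def) (simp add: mat_def)

lemma integer_orthogonal_mul:
  "U \<in> integer_orthogonal \<Longrightarrow> V \<in> integer_orthogonal \<Longrightarrow> U ** V \<in> integer_orthogonal"
  by (simp add: integer_orthogonal_def orthogonal_matrix_mul)
     (auto simp: matrix_matrix_mult_def intro!: Ints_sum Ints_mult)

text \<open>The sum is invariant under conjugation by signed permutation matrices, hence scalar.\<close>

lemma sum_integer_orthogonal_conj:
  fixes P :: "real^'n^'n"
  shows "(\<Sum>V\<in>integer_orthogonal. V ** P ** transpose V)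
    = (card (integer_orthogonal :: (real^'n^'n) set) * (trace P / CARD('n))) *\<^sub>R mat 1"
proof -
  let ?S = "integer_orthogonal :: (real^'n^'n) set"
  define M where "M = (\<Sum>V\<in>?S. V ** P ** transpose V)"
  have M: "M $ a $ b = (\<Sum>V\<in>?S. (V ** P ** transpose V) $ a $ b)" for a b
    by (simp add: M_def)
  have inv: "M $ a $ b = d a * d b * M $ \<pi> a $ \<pi> b"
    if \<pi>: "\<And>a. \<pi> (\<pi> a) = a" and d: "\<And>a. d a = 1 \<or> d a = -1" for \<pi> :: "'n \<Rightarrow> 'n" and d :: "'n \<Rightarrow> real" and a b
  proof -
    \<comment> \<open>The signed permutation matrix of the involution \<pi> with signs
      \<open>d\<close>. A single sign change will kill off-diagonal entries, and a transposition
      will equate diagonal ones.\<close>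
    define W :: "real^'n^'n" where "W = (\<chi> a b. if b = \<pi> a then d a else 0)"
    have WX: "(W ** X ** transpose W) $ a $ b = d a * d b * X $ \<pi> a $ \<pi> b" for X a b
      by (simp add: W_def matrix_matrix_mult_def transpose_def if_distrib if_distribR cong: if_cong)
    have inj: "\<pi> a = \<pi> b \<longleftrightarrow> a = b" for a b by (metis \<pi>)
    have dd: "d a * d a = 1" for a using d[of a] by auto
    have "W ** mat 1 ** transpose W = mat 1"
      by (simp add: vec_eq_iff WX del: matrix_mul_rid) (auto simp: mat_def inj dd)
    then have WW: "W ** transpose W = mat 1" by simp
    then have WW': "transpose W ** W = mat 1" by (simp add: matrix_left_right_inverse)
    have W: "W \<in> ?S"
      using d WW' unfolding integer_orthogonal_def orthogonal_matrix
      by (auto simp: W_def) (metis Ints_1 Ints_minus)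
    have Wt: "transpose W \<in> ?S"
      using W by (simp add: integer_orthogonal_def) (simp add: transpose_def)
    \<comment> \<open>Left multiplication by \<open>W\<close> permutes the group, so conjugation by
      \<open>W\<close> fixes the sum.\<close>
    have "bij_betw (\<lambda>V. W ** V) ?S ?S"
      by (rule bij_betwI[where g = "\<lambda>V. transpose W ** V"])
         (auto simp: integer_orthogonal_mul W Wt matrix_mul_assoc WW WW')
    then have "M $ a $ b = (\<Sum>V\<in>?S. ((W ** V) ** P ** transpose (W ** V)) $ a $ b)"
      unfolding M by (rule sum.reindex_bij_betw[symmetric])
    also have "\<dots> = (\<Sum>V\<in>?S. (W ** (V ** P ** transpose V) ** transpose W) $ a $ b)"
      by (simp add: matrix_transpose_mul matrix_mul_assoc)
    also have "\<dots> = d a * d b * M $ \<pi> a $ \<pi> b"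
      unfolding WX M by (simp add: sum_distrib_left)
    finally show ?thesis .
  qed
  have off: "M $ a $ b = 0" if "a \<noteq> b" for a b
    using inv[of "\<lambda>x. x" "\<lambda>x. if x = a then -1 else 1" a b] that by simp
  have diag: "M $ a $ a = M $ b $ b" for a b
    using inv[of "Transposition.transpose a b" "\<lambda>_. 1" a a] by simp
  have "(\<Sum>a\<in>UNIV. M $ a $ a) = (\<Sum>V\<in>?S. trace (V ** P ** transpose V))"
    unfolding M trace_def by (rule sum.swap)
  also have "\<dots> = (\<Sum>V\<in>?S. trace P)"
  proof (rule sum.cong)
    fix V assume "V \<in> ?S"
    then have "transpose V ** V = mat 1"
      by (simp add: integer_orthogonal_def orthogonal_matrix)
    then show "trace (V ** P ** transpose V) = trace P"
      by (subst trace_mul_sym) (simp add: matrix_mul_assoc)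
  qed simp
  finally have tr: "(\<Sum>a\<in>UNIV. M $ a $ a) = card ?S * trace P" by simp
  have "CARD('n) * M $ a $ a = card ?S * trace P" for a
  proof -
    have "(\<Sum>b\<in>UNIV. M $ b $ b) = (\<Sum>b\<in>(UNIV :: 'n set). M $ a $ a)"
      by (intro sum.cong refl diag)
    with tr show ?thesis by simp
  qed
  then have "M $ a $ a = card ?S * (trace P / CARD('n))" for a
    by (simp add: field_simps)
  with off have "M = (card ?S * (trace P / CARD('n))) *\<^sub>R mat 1"
    by (simp add: vec_eq_iff mat_def)
  then show ?thesis by (simp add: M_def)
qed

section \<open>Comparison of a single matrix\<close>

lemma axis_axis_Basis: "axis i (axis j (1::real)) \<in> (Basis :: (real^'n^'m) set)"
  by (simp add: axis_in_Basis_iff)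

text \<open>Expanded, the squared norm is the sum of G_ij G_kj G_il G_kl. Its mean is supported on i
  = k or j = l; n^3 quadruples satisfy each condition and n^2 both, which gives n^2 (2n + 1)
  q.\<close>

lemma integral_norm_gram_std_gaussian:
  defines "\<phi> \<equiv> (\<integral>G. norm G \<partial>(std_gaussian :: (real^'n^'n) measure))"
  shows "integrable std_gaussian (\<lambda>G::real^'n^'n. (norm (G ** transpose G))\<^sup>2 / norm G ^ 3)" (is ?I)
    and "(\<integral>G. (norm (G ** transpose G))\<^sup>2 / norm G ^ 3 \<partial>(std_gaussian :: (real^'n^'n) measure))
      = (2 * real CARD('n) + 1) / ((real CARD('n))\<^sup>2 + 2) * \<phi>" (is ?E)
proof -
  let ?n = "real CARD('n)"
  define e :: "'n \<Rightarrow> 'n \<Rightarrow> real^'n^'n" where "e i j = axis i (axis j 1)" for i j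
  have eB: "e i j \<in> Basis" for i j by (simp add: e_def axis_axis_Basis)
  have e_eq: "e i j = e k l \<longleftrightarrow> i = k \<and> j = l" for i j k l
    by (auto simp: e_def axis_eq_axis)
  have ne: "norm (e i j) = 1" for i j by (simp add: eB)
  have Ge: "G $ i $ j = G \<bullet> e i j" for G i j by (simp add: e_def inner_axis)
  have eq: "(norm (G ** transpose G))\<^sup>2 / norm G ^ 3 = (\<Sum>i\<in>UNIV. \<Sum>k\<in>UNIV. \<Sum>j\<in>UNIV. \<Sum>l\<in>UNIV.
      (G \<bullet> e i j) * (G \<bullet> e k j) * (G \<bullet> e i l) * (G \<bullet> e k l) / norm G ^ 3)" for G :: "real^'n^'n"
  proof -
    have "(norm (G ** transpose G))\<^sup>2 = (\<Sum>i\<in>UNIV. \<Sum>k\<in>UNIV. (\<Sum>j\<in>UNIV. G $ i $ j * G $ k $ j) * (\<Sum>l\<in>UNIV. G $ i $ l * G $ k $ l))"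
      by (simp add: power2_norm_eq_inner inner_matrix matrix_matrix_mult_def transpose_def)
    also have "\<dots> = (\<Sum>i\<in>UNIV. \<Sum>k\<in>UNIV. \<Sum>j\<in>UNIV. \<Sum>l\<in>UNIV. G $ i $ j * G $ k $ j * G $ i $ l * G $ k $ l)"
      by (simp only: sum_product mult.assoc)
    finally show ?thesis by (simp only: sum_divide_distrib Ge)
  qed
  have int: "integrable std_gaussian (\<lambda>G. (G \<bullet> e i j) * (G \<bullet> e k j) * (G \<bullet> e i l) * (G \<bullet> e k l) / norm G ^ 3)" for i j k l
    by (intro integrable_quartic ne)
  show ?I unfolding eq by (intro Bochner_Integration.integrable_sum int)
  define q where "q = \<phi> / (?n\<^sup>2 * (?n\<^sup>2 + 2))"
  have D: "real DIM(real^'n^'n) = ?n\<^sup>2" by (simp add: power2_eq_square)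
  \<comment> \<open>When both coincidences occur the moment is 3q, one q more than the two
    conditions contribute separately; hence the third summand.\<close>
  have Q: "quartic_moment (e i j) (e k j) (e i l) (e k l)
      = (if i = k then q else 0) + (if j = l then q else 0) + (if i = k then if j = l then q else 0 else 0)" for i j k l
  proof -
    have 1: "quartic_moment (e i j) (e i j) (e i l) (e i l) = (if j = l then 3 else 1) * q"
      unfolding quartic_moment_eq[OF eB eB] D by (simp add: q_def \<phi>_def e_eq)
    have 2: "quartic_moment (e i j) (e k j) (e i j) (e k j) = (if i = k then 3 else 1) * q"
      unfolding quartic_moment_commute[of "e i j" "e k j"]
      unfolding quartic_moment_eq[OF eB eB] D by (simp add: q_def \<phi>_def e_eq)
    have 3: "quartic_moment (e i j) (e k j) (e i l) (e k l) = 0" if "i \<noteq> k" "j \<noteq> l"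
      by (rule quartic_moment_flip) (use that in \<open>auto simp: eB e_eq\<close>)
    show ?thesis
      using 1 2 3 by (cases "i = k"; cases "j = l") auto
  qed
  have "(\<integral>G. (norm (G ** transpose G))\<^sup>2 / norm G ^ 3 \<partial>(std_gaussian :: (real^'n^'n) measure))
      = (\<Sum>i\<in>UNIV. \<Sum>k\<in>UNIV. \<Sum>j\<in>UNIV. \<Sum>l\<in>UNIV. quartic_moment (e i j) (e k j) (e i l) (e k l))"
    unfolding eq quartic_moment_def
    by (simp add: Bochner_Integration.integral_sum int Bochner_Integration.integrable_sum)
  also have "\<dots> = (\<Sum>i\<in>(UNIV::'n set). \<Sum>k\<in>UNIV. (if i = k then ?n * ?n * q + ?n * q else 0) + ?n * q)"
    unfolding Q by (intro sum.cong refl) (simp add: sum.distrib algebra_simps)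
  also have "\<dots> = ?n\<^sup>2 * (2 * ?n + 1) * q"
    by (simp add: sum.distrib power2_eq_square algebra_simps)
  also have "\<dots> = (2 * ?n + 1) / (?n\<^sup>2 + 2) * \<phi>"
    by (simp add: q_def)
  finally show ?E .
qed

text \<open>This choice of \<open>c\<close> maximizes the integral, which then equals the mean of the norm divided by \<open>c\<close>.\<close>

lemma std_gaussian_trace_bound:
  defines "c \<equiv> sqrt ((2 * real CARD('n) + 1) / ((real CARD('n))\<^sup>2 + 2))"
  shows "integrable std_gaussian (\<lambda>G::real^'n^'n. 3 / (2 * c) * norm G - (norm (G ** transpose G))\<^sup>2 / norm G ^ 3 / (2 * c ^ 3))" (is ?I)
    and "2 / 3 * real CARD('n) * sqrt CARD('n) \<le>
      (\<integral>G. 3 / (2 * c) * norm G - (norm (G ** transpose G))\<^sup>2 / norm G ^ 3 / (2 * c ^ 3) \<partial>(std_gaussian :: (real^'n^'n) measure))" (is ?E)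
proof -
  let ?n = "real CARD('n)"
  let ?\<phi> = "\<integral>G. norm G \<partial>(std_gaussian :: (real^'n^'n) measure)"
  have n: "?n \<ge> 1" by (simp add: Suc_leI)
  have c2: "c\<^sup>2 = (2 * ?n + 1) / (?n\<^sup>2 + 2)" unfolding c_def by (intro real_sqrt_pow2) simp
  have c: "c > 0" unfolding c_def by (intro real_sqrt_gt_zero divide_pos_pos add_nonneg_pos) auto
  have i: "integrable (std_gaussian :: (real^'n^'n) measure) norm"
    using integrable_norm_power_std_gaussian[of 1, where 'a = "real^'n^'n"] by simp
  note g = integral_norm_gram_std_gaussian[where 'n='n]
  define R where "R G = (norm (G ** transpose G))\<^sup>2 / norm G ^ 3" for G :: "real^'n^'n"
  have R: "integrable std_gaussian R" "(\<integral>G. R G \<partial>std_gaussian) = c\<^sup>2 * ?\<phi>"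
    unfolding R_def c2 by (rule g)+
  show ?I unfolding R_def[symmetric] using i R(1) by simp
  have "(\<integral>G. 3 / (2 * c) * norm G - (norm (G ** transpose G))\<^sup>2 / norm G ^ 3 / (2 * c ^ 3) \<partial>(std_gaussian :: (real^'n^'n) measure))
      = 3 / (2 * c) * ?\<phi> - c\<^sup>2 * ?\<phi> / (2 * c ^ 3)"
    unfolding R_def[symmetric] using i R by simp
  also have "\<dots> = ?\<phi> / c"
    using c by (simp add: field_simps eval_nat_numeral)
  finally have E: "(\<integral>G. 3 / (2 * c) * norm G - (norm (G ** transpose G))\<^sup>2 / norm G ^ 3 / (2 * c ^ 3) \<partial>(std_gaussian :: (real^'n^'n) measure)) = ?\<phi> / c" .
  have "2 / 3 * ?n * sqrt ?n * c \<le> ?n\<^sup>2 / sqrt (?n\<^sup>2 + 1)"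
  proof (rule power2_le_imp_le)
    \<comment> \<open>After squaring, the claim is 9n (n^2 + 2) - 4 (2n + 1) (n^2 + 1) \<ge> 0; the
      left-hand side equals n^3 - 4n^2 + 10n - 4, written here as visibly nonnegative parts.\<close>
    have "0 \<le> ?n * (?n - 2)\<^sup>2 + (6 * ?n - 4)" using n by (intro add_nonneg_nonneg mult_nonneg_nonneg; (simp; fail | linarith))
    then have p: "4 * ((2 * ?n + 1) * (?n\<^sup>2 + 1)) \<le> 9 * (?n * (?n\<^sup>2 + 2))"
      by (simp add: power2_eq_square algebra_simps)
    have "(2 / 3 * ?n * sqrt ?n * c)\<^sup>2 = 4 / 9 * ?n\<^sup>2 * ?n * ((2 * ?n + 1) / (?n\<^sup>2 + 2))"
      unfolding c2[symmetric] by (simp add: power_mult_distrib power2_eq_square)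
    also have "\<dots> = ?n ^ 3 / (9 * (?n\<^sup>2 + 2) * (?n\<^sup>2 + 1)) * (4 * ((2 * ?n + 1) * (?n\<^sup>2 + 1)))"
      by (simp add: divide_simps add_nonneg_eq_0_iff power3_eq_cube power2_eq_square)
    also have "\<dots> \<le> ?n ^ 3 / (9 * (?n\<^sup>2 + 2) * (?n\<^sup>2 + 1)) * (9 * (?n * (?n\<^sup>2 + 2)))"
      by (intro mult_left_mono p) auto
    also have "\<dots> = ?n ^ 4 / (?n\<^sup>2 + 1)"
      by (simp add: divide_simps add_nonneg_eq_0_iff eval_nat_numeral)
    also have "\<dots> = (?n\<^sup>2 / sqrt (?n\<^sup>2 + 1))\<^sup>2"
      by (simp add: power_divide flip: power_mult)
    finally show "(2 / 3 * ?n * sqrt ?n * c)\<^sup>2 \<le> (?n\<^sup>2 / sqrt (?n\<^sup>2 + 1))\<^sup>2" .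
  qed simp
  also have "\<dots> \<le> ?\<phi>"
    using std_gaussian_norm_moment_1_ge[where 'a = "real^'n^'n"] by (simp add: power2_eq_square)
  finally have "2 / 3 * ?n * sqrt ?n \<le> ?\<phi> / c"
    using c by (simp add: pos_le_divide_eq)
  then show ?E unfolding E .
qed

section \<open>Haar measure and convex functions\<close>

lemma haar_orthogonalD:
  assumes "haar_orthogonal (\<mu> :: (real^'n^'n) measure)"
  shows "prob_space \<mu>" "sets \<mu> = sets borel" "AE Q in \<mu>. orthogonal_matrix Q"
    "\<And>U. orthogonal_matrix U \<Longrightarrow> distr \<mu> borel (\<lambda>Q. U ** Q) = \<mu>"
proof -
  show p: "prob_space \<mu>" and s: "sets \<mu> = sets borel"
    and "\<And>U. orthogonal_matrix U \<Longrightarrow> distr \<mu> borel (\<lambda>Q. U ** Q) = \<mu>"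
    using assms by (auto simp: haar_orthogonal_def)
  interpret prob_space \<mu> by (rule p)
  have "prob {Q. orthogonal_matrix Q} = 1"
    using assms by (simp add: haar_orthogonal_def measure_def)
  then show "AE Q in \<mu>. orthogonal_matrix Q"
    using prob_eq_1[of "{Q. orthogonal_matrix Q}"] compact_orthogonal[where 'n='n]
    by (auto simp: s compact_imp_closed)
qed

lemma borel_measurable_matrix_mul [measurable]:
  "(\<lambda>X. V ** X :: real^'n^'m) \<in> borel \<rightarrow>\<^sub>M borel" "(\<lambda>X. X ** V :: real^'n^'m) \<in> borel \<rightarrow>\<^sub>M borel"
  unfolding matrix_matrix_mult_def
  by (intro borel_measurable_continuous_onI continuous_intros; simp)+

lemma haar_orthogonal_integral:
  fixes g :: "real^'n^'n \<Rightarrow> real"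
  assumes \<mu>: "haar_orthogonal \<mu>" and U: "orthogonal_matrix U" and [measurable]: "g \<in> borel_measurable borel"
  shows "(\<integral>Q. g (U ** Q) \<partial>\<mu>) = (\<integral>Q. g Q \<partial>\<mu>)"
proof -
  note [measurable_cong] = haar_orthogonalD(2)[OF \<mu>]
  show ?thesis
    by (subst (2) haar_orthogonalD(4)[OF \<mu> U, symmetric]) (simp add: integral_distr)
qed

text \<open>A continuous function is bounded on the compact group that carries \<mu>, so integrals
  over \<open>Q\<close> are finite even where the Gaussian side may be infinite.\<close>

lemma haar_orthogonal_integrable:
  fixes h :: "real^'n^'n \<Rightarrow> real"
  assumes \<mu>: "haar_orthogonal \<mu>" and h: "continuous_on UNIV h"
  shows "integrable \<mu> (\<lambda>Q. h (A ** Q))"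
proof -
  interpret prob_space \<mu> by (rule haar_orthogonalD[OF \<mu>])
  note [measurable_cong] = haar_orthogonalD(2)[OF \<mu>]
  have [measurable]: "h \<in> borel_measurable borel" by (rule borel_measurable_continuous_onI[OF h])
  have "continuous_on {Q. orthogonal_matrix Q} (\<lambda>Q. h (A ** Q))"
    by (intro continuous_on_compose2[OF h]) (auto simp: matrix_matrix_mult_def intro!: continuous_intros)
  then have "bounded ((\<lambda>Q. h (A ** Q)) ` {Q. orthogonal_matrix Q})"
    by (intro compact_imp_bounded compact_continuous_image compact_orthogonal)
  then obtain B where B: "\<And>Q. orthogonal_matrix Q \<Longrightarrow> norm (h (A ** Q)) \<le> B"
    by (auto simp: bounded_iff)
  show ?thesis
    by (rule integrable_const_bound[where B = B]) (use haar_orthogonalD(3)[OF \<mu>] in \<open>auto elim!: eventually_mono dest: B\<close>)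
qed

text \<open>\<open>ennreal\<close> truncates negative values to 0, which can only increase the
  integral. Needed because the tangent-line bound below may be negative for some
  \<open>G\<close>.\<close>

lemma ennreal_integral_le_nn_integral:
  assumes f: "integrable M f"
  shows "ennreal (\<integral>x. f x \<partial>M) \<le> (\<integral>\<^sup>+x. ennreal (f x) \<partial>M)"
proof -
  have "ennreal (\<integral>x. f x \<partial>M) \<le> ennreal (\<integral>x. max 0 (f x) \<partial>M)"
    using f by (intro ennreal_leI integral_mono) auto
  also have "\<dots> = (\<integral>\<^sup>+x. ennreal (max 0 (f x)) \<partial>M)"
    using f by (intro nn_integral_eq_integral[symmetric]) auto
  also have "\<dots> = (\<integral>\<^sup>+x. ennreal (f x) \<partial>M)"
    by (intro nn_integral_cong) (simp add: max_def ennreal_neg)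
  finally show ?thesis .
qed

text \<open>Everything is compared with the one-variable convex function \<open>k t\<close>, the
  Haar mean of h at t Q. Its tangent at \<open>t = 1\<close> serves as Jensen's inequality in
  \<open>G\<close>, and it is affine in the bound \<open>D G\<close>, whose mean is known.\<close>

lemma haar_convex_le_gaussian:
  fixes h :: "real^'n^'n \<Rightarrow> real"
  assumes \<mu>: "haar_orthogonal \<mu>" and h: "convex_on UNIV h" and h0: "\<And>X. 0 \<le> h X"
  shows "(\<integral>\<^sup>+Q. ennreal (h Q) \<partial>\<mu>) \<le> (\<integral>\<^sup>+G. ennreal (h ((3 / (2 * sqrt CARD('n))) *\<^sub>R G)) \<partial>std_gaussian)"
proof -
  let ?n = "real CARD('n)"
  let ?S = "integer_orthogonal :: (real^'n^'n) set"
  define s where "s = 3 / (2 * sqrt ?n)"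
  have s: "s > 0" by (simp add: s_def)
  interpret M: prob_space \<mu> by (rule haar_orthogonalD[OF \<mu>])
  interpret \<Gamma>: prob_space "std_gaussian :: (real^'n^'n) measure" by (rule prob_space_std_gaussian)
  interpret P: pair_sigma_finite "std_gaussian :: (real^'n^'n) measure" \<mu> ..
  note [measurable_cong] = haar_orthogonalD(2)[OF \<mu>]
  have hc: "continuous_on UNIV h" by (rule convex_on_continuous[OF open_UNIV h])
  have [measurable]: "h \<in> borel_measurable borel" by (rule borel_measurable_continuous_onI[OF hc])
  define k where "k t = (\<integral>Q. h (t *\<^sub>R Q) \<partial>\<mu>)" for t
  have tQ: "t *\<^sub>R Q = (t *\<^sub>R mat 1) ** Q" for t and Q :: "real^'n^'n"
    by (simp add: vec_eq_iff matrix_matrix_mult_def mat_def if_distrib if_distribR cong: if_cong)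
  have ki: "integrable \<mu> (\<lambda>Q. h (t *\<^sub>R Q))" for t
    using haar_orthogonal_integrable[OF \<mu> hc, of "t *\<^sub>R mat 1"] by (simp only: tQ[symmetric])
  have kconv: "convex_on UNIV k"
  proof (rule convex_onI)
    fix t x y :: real assume t: "0 < t" "t < 1"
    have "h (((1 - t) * x + t * y) *\<^sub>R Q) \<le> (1 - t) * h (x *\<^sub>R Q) + t * h (y *\<^sub>R Q)" for Q
      using convex_onD[OF h, of t "x *\<^sub>R Q" "y *\<^sub>R Q"] t by (simp add: algebra_simps)
    then have "k ((1 - t) *\<^sub>R x + t *\<^sub>R y) \<le> (\<integral>Q. (1 - t) * h (x *\<^sub>R Q) + t * h (y *\<^sub>R Q) \<partial>\<mu>)"
      unfolding k_def using ki by (intro integral_mono) auto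
    also have "\<dots> = (1 - t) * k x + t * k y" unfolding k_def using ki by simp
    finally show "k ((1 - t) *\<^sub>R x + t *\<^sub>R y) \<le> (1 - t) * k x + t * k y" .
  qed simp
  \<comment> \<open>Since \<open>- mat 1\<close> is orthogonal, \<open>k\<close> is even; hence its
    subgradient at 1 is nonnegative, and a lower bound for the trace suffices.\<close>
  have neg: "(- mat 1) ** Q = - Q" for Q :: "real^'n^'n"
    using tQ[of "-1" Q] by simp
  have "transpose (- mat 1 :: real^'n^'n) = - mat 1"
    by (simp add: vec_eq_iff transpose_def mat_def)
  then have om: "orthogonal_matrix (- mat 1 :: real^'n^'n)"
    by (simp add: orthogonal_matrix neg)
  have keven: "k (- t) = k t" for t
    using haar_orthogonal_integral[OF \<mu> om, of "\<lambda>Q. h (t *\<^sub>R Q)"] by (simp add: k_def neg)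
  obtain \<sigma> where \<sigma>: "\<And>t. k 1 + \<sigma> * (t - 1) \<le> k t"
    using convex_le_Inf_differential[OF kconv, of 1] by auto
  have \<sigma>0: "\<sigma> \<ge> 0" using \<sigma>[of "-1"] keven[of 1] by simp
  define c where "c = sqrt ((2 * ?n + 1) / (?n\<^sup>2 + 2))"
  define D where "D G = 3 / (2 * c) * norm G - (norm (G ** transpose G))\<^sup>2 / norm G ^ 3 / (2 * c ^ 3)" for G :: "real^'n^'n"
  have c: "c > 0" unfolding c_def by (intro real_sqrt_gt_zero divide_pos_pos add_nonneg_pos) auto
  have Di: "integrable std_gaussian D" and D: "2 / 3 * ?n * sqrt ?n \<le> (\<integral>G. D G \<partial>std_gaussian)"
    unfolding D_def c_def by (rule std_gaussian_trace_bound)+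
  have S: "finite ?S" "card ?S > 0"
    using finite_integer_orthogonal mat_1_integer_orthogonal by (auto simp: card_gt_0_iff)
  have int: "integrable \<mu> (\<lambda>Q. h (s *\<^sub>R (A ** Q)))" for A
  proof -
    have "s *\<^sub>R (A ** Q) = (s *\<^sub>R A) ** Q" for Q :: "real^'n^'n" by (simp add: scalar_matrix_assoc)
    then show ?thesis using haar_orthogonal_integrable[OF \<mu> hc, of "s *\<^sub>R A"] by simp
  qed
  have key: "card ?S * (k 1 + \<sigma> * (s * D G / ?n - 1)) \<le> (\<Sum>V\<in>?S. \<integral>Q. h (s *\<^sub>R (V ** G ** Q)) \<partial>\<mu>)" for G
  proof -
    obtain W where W: "orthogonal_matrix W" and tr: "D G \<le> trace (G ** W)"
      using exists_orthogonal_trace_ge[OF c, of G] unfolding D_def by blast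
    define P where "P = G ** W"
    define t where "t = s * (trace P / ?n)"
    have "s * D G / ?n \<le> t"
      using tr s by (simp add: t_def P_def divide_right_mono)
    then have "k 1 + \<sigma> * (s * D G / ?n - 1) \<le> k 1 + \<sigma> * (t - 1)"
      using \<sigma>0 by (intro add_left_mono mult_left_mono) auto
    also have "\<dots> \<le> k t" by (rule \<sigma>)
    finally have "card ?S * (k 1 + \<sigma> * (s * D G / ?n - 1)) \<le> card ?S * k t"
      by (intro mult_left_mono) auto
    also have "card ?S * k t = (\<integral>Q. card ?S * h (t *\<^sub>R Q) \<partial>\<mu>)"
      unfolding k_def by simp
    also have "\<dots> \<le> (\<integral>Q. (\<Sum>V\<in>?S. h (s *\<^sub>R (V ** P ** transpose V ** Q))) \<partial>\<mu>)"
    proof (rule integral_mono)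
      show "integrable \<mu> (\<lambda>Q. card ?S * h (t *\<^sub>R Q))" using ki by simp
      show "integrable \<mu> (\<lambda>Q. \<Sum>V\<in>?S. h (s *\<^sub>R (V ** P ** transpose V ** Q)))"
        by (intro Bochner_Integration.integrable_sum int)
      fix Q :: "real^'n^'n"
      have lin: "linear (\<lambda>X. X ** Q)"
        by (auto intro!: linearI simp: matrix_matrix_mult_def vec_eq_iff algebra_simps sum.distrib sum_distrib_left)
      have "(\<Sum>V\<in>?S. (1 / card ?S) *\<^sub>R (s *\<^sub>R (V ** P ** transpose V ** Q)))
          = (s / card ?S) *\<^sub>R (\<Sum>V\<in>?S. V ** P ** transpose V ** Q)"
        by (simp add: scaleR_sum_right mult.commute)
      also have "(\<Sum>V\<in>?S. V ** P ** transpose V ** Q) = (\<Sum>V\<in>?S. V ** P ** transpose V) ** Q"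
        by (rule linear_sum[OF lin, symmetric])
      also have "\<dots> = (card ?S * (trace P / ?n)) *\<^sub>R Q"
        unfolding sum_integer_orthogonal_conj tQ[symmetric] ..
      finally have sum: "(\<Sum>V\<in>?S. (1 / card ?S) *\<^sub>R (s *\<^sub>R (V ** P ** transpose V ** Q))) = t *\<^sub>R Q"
        using S by (auto simp: t_def card_gt_0_iff)
      have "h (t *\<^sub>R Q) \<le> (\<Sum>V\<in>?S. (1 / card ?S) * h (s *\<^sub>R (V ** P ** transpose V ** Q)))"
        unfolding sum[symmetric] using S by (intro convex_on_sum[OF _ _ h]) (auto simp: card_gt_0_iff)
      then show "card ?S * h (t *\<^sub>R Q) \<le> (\<Sum>V\<in>?S. h (s *\<^sub>R (V ** P ** transpose V ** Q)))"
        using S by (simp add: sum_divide_distrib[symmetric] field_simps)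
    qed
    also have "\<dots> = (\<Sum>V\<in>?S. \<integral>Q. h (s *\<^sub>R (V ** P ** transpose V ** Q)) \<partial>\<mu>)"
      by (intro Bochner_Integration.integral_sum int)
    also have "\<dots> = (\<Sum>V\<in>?S. \<integral>Q. h (s *\<^sub>R (V ** G ** Q)) \<partial>\<mu>)"
    proof (intro sum.cong refl)
      fix V assume "V \<in> ?S"
      then have "orthogonal_matrix (W ** transpose V)"
        using W by (simp add: integer_orthogonal_def orthogonal_matrix_mul)
      \<comment> \<open>Invariance under \<open>W ** transpose V\<close> absorbs the polar factor,
        the only object depending on \<open>G\<close> without a known measurable form.\<close>
      from haar_orthogonal_integral[OF \<mu> this, of "\<lambda>Q. h (s *\<^sub>R (V ** G ** Q))"]
      show "(\<integral>Q. h (s *\<^sub>R (V ** P ** transpose V ** Q)) \<partial>\<mu>) = (\<integral>Q. h (s *\<^sub>R (V ** G ** Q)) \<partial>\<mu>)"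
        by (simp add: P_def matrix_mul_assoc)
    qed
    finally show ?thesis .
  qed
  have meas [measurable]: "(\<lambda>(G, Q). h (s *\<^sub>R (V ** G ** Q))) \<in> borel_measurable (std_gaussian \<Otimes>\<^sub>M \<mu>)" for V
  proof -
    have cont: "continuous_on UNIV (\<lambda>p. h (s *\<^sub>R (V ** fst p ** snd p)))"
      unfolding matrix_matrix_mult_def by (intro continuous_on_compose2[OF hc] continuous_intros) auto
    have "(\<lambda>p. h (s *\<^sub>R (V ** fst p ** snd p))) \<in> borel_measurable (borel \<Otimes>\<^sub>M borel)"
      unfolding borel_prod by (rule borel_measurable_continuous_onI[OF cont])
    then show ?thesis
      by (simp add: split_beta' haar_orthogonalD(2)[OF \<mu>] cong: measurable_cong_sets sets_pair_measure_cong)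
  qed
  \<comment> \<open>For almost every \<open>Q\<close>, namely each orthogonal one, the map from
    \<open>G\<close> to \<open>V ** G ** Q\<close> preserves the Gaussian law; Tonelli then puts the
    Haar integral inside.\<close>
  have gauss: "(\<integral>\<^sup>+G. ennreal (h (s *\<^sub>R G)) \<partial>std_gaussian) = (\<integral>\<^sup>+G. ennreal (\<integral>Q. h (s *\<^sub>R (V ** G ** Q)) \<partial>\<mu>) \<partial>std_gaussian)"
    if V: "V \<in> ?S" for V
  proof -
    have "(\<integral>\<^sup>+G. ennreal (h (s *\<^sub>R G)) \<partial>std_gaussian) = (\<integral>\<^sup>+Q. (\<integral>\<^sup>+G. ennreal (h (s *\<^sub>R G)) \<partial>std_gaussian) \<partial>\<mu>)"
      by (simp add: M.emeasure_space_1)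
    also have "\<dots> = (\<integral>\<^sup>+Q. (\<integral>\<^sup>+G. ennreal (h (s *\<^sub>R (V ** G ** Q))) \<partial>std_gaussian) \<partial>\<mu>)"
    proof (rule nn_integral_cong_AE)
      show "AE Q in \<mu>. (\<integral>\<^sup>+G. ennreal (h (s *\<^sub>R G)) \<partial>std_gaussian) = (\<integral>\<^sup>+G. ennreal (h (s *\<^sub>R (V ** G ** Q))) \<partial>std_gaussian)"
        using haar_orthogonalD(3)[OF \<mu>]
      proof eventually_elim
        case (elim Q)
        have "orthogonal_transformation (\<lambda>G. V ** G ** Q)"
          using V elim by (simp add: integer_orthogonal_def orthogonal_transformation_matrix_mul)
        from distr_std_gaussian_orthogonal[OF this, symmetric]
        show ?case by (rule ssubst) (simp add: nn_integral_distr)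
      qed
    qed
    also have "\<dots> = (\<integral>\<^sup>+G. (\<integral>\<^sup>+Q. ennreal (h (s *\<^sub>R (V ** G ** Q))) \<partial>\<mu>) \<partial>std_gaussian)"
      by (rule P.Fubini') measurable
    also have "\<dots> = (\<integral>\<^sup>+G. ennreal (\<integral>Q. h (s *\<^sub>R (V ** G ** Q)) \<partial>\<mu>) \<partial>std_gaussian)"
      using int h0 by (intro nn_integral_cong nn_integral_eq_integral) auto
    finally show ?thesis .
  qed
  let ?R = "\<integral>\<^sup>+G. ennreal (h (s *\<^sub>R G)) \<partial>std_gaussian"
  have "k 1 \<le> k 1 + \<sigma> * (s * (\<integral>G. D G \<partial>std_gaussian) / ?n - 1)"
  proof -
    \<comment> \<open>The constant 3/2 is exactly what makes the mean of the tangent argument at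
      least 1.\<close>
    have "1 = s * (2 / 3 * ?n * sqrt ?n) / ?n" by (simp add: s_def)
    also have "\<dots> \<le> s * (\<integral>G. D G \<partial>std_gaussian) / ?n"
      using D s by (intro divide_right_mono mult_left_mono) auto
    finally show ?thesis using \<sigma>0 by simp
  qed
  then have "card ?S * k 1 \<le> card ?S * (k 1 + \<sigma> * (s * (\<integral>G. D G \<partial>std_gaussian) / ?n - 1))"
    by (intro mult_left_mono) auto
  also have "\<dots> = (\<integral>G. card ?S * (k 1 + \<sigma> * (s * D G / ?n - 1)) \<partial>std_gaussian)"
    using Di \<Gamma>.prob_space by simp
  finally have "ennreal (card ?S * k 1) \<le> ennreal (\<integral>G. card ?S * (k 1 + \<sigma> * (s * D G / ?n - 1)) \<partial>std_gaussian)"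
    by (rule ennreal_leI)
  also have "\<dots> \<le> (\<integral>\<^sup>+G. ennreal (card ?S * (k 1 + \<sigma> * (s * D G / ?n - 1))) \<partial>std_gaussian)"
    using Di by (intro ennreal_integral_le_nn_integral) simp
  also have "\<dots> \<le> (\<integral>\<^sup>+G. ennreal (\<Sum>V\<in>?S. \<integral>Q. h (s *\<^sub>R (V ** G ** Q)) \<partial>\<mu>) \<partial>std_gaussian)"
    by (intro nn_integral_mono ennreal_leI key)
  also have "\<dots> = (\<integral>\<^sup>+G. (\<Sum>V\<in>?S. ennreal (\<integral>Q. h (s *\<^sub>R (V ** G ** Q)) \<partial>\<mu>)) \<partial>std_gaussian)"
    using h0 by (intro nn_integral_cong) (simp add: sum_ennreal)
  also have "\<dots> = (\<Sum>V\<in>?S. \<integral>\<^sup>+G. ennreal (\<integral>Q. h (s *\<^sub>R (V ** G ** Q)) \<partial>\<mu>) \<partial>std_gaussian)"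
  proof (rule nn_integral_sum)
    fix V assume "V \<in> ?S"
    show "(\<lambda>G. ennreal (\<integral>Q. h (s *\<^sub>R (V ** G ** Q)) \<partial>\<mu>)) \<in> borel_measurable std_gaussian"
      by measurable
  qed
  also have "\<dots> = card ?S * ?R"
    by (simp add: gauss[symmetric])
  finally have "ennreal (card ?S) * ennreal (k 1) \<le> ennreal (card ?S) * ?R"
    by (simp add: ennreal_mult' ennreal_of_nat_eq_real_of_nat)
  then have "ennreal (k 1) \<le> ?R"
    using S(2) by (subst (asm) ennreal_mult_le_mult_iff) auto
  moreover have "ennreal (k 1) = (\<integral>\<^sup>+Q. ennreal (h Q) \<partial>\<mu>)"
    unfolding k_def using ki[of 1] h0 by (subst nn_integral_eq_integral) auto
  ultimately show ?thesis by (simp add: s_def)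
qed

section \<open>Independent families\<close>

lemma measure_eqI_box:
  fixes M N :: "'a::euclidean_space measure"
  assumes sets: "sets M = sets borel" "sets N = sets borel" and fin: "finite_measure M"
    and eq: "\<And>l u. emeasure M (box l u) = emeasure N (box l u)"
  shows "M = N"
proof (rule measure_eqI_generator_eq)
  let ?E = "range (\<lambda>(a, b). box a b::'a set)"
  show "Int_stable ?E"
    by (auto simp: Int_stable_def box_Int_box)
  show "?E \<subseteq> Pow UNIV" "sets M = sigma_sets UNIV ?E" "sets N = sigma_sets UNIV ?E"
    by (simp_all add: sets borel_eq_box)
  let ?A = "\<lambda>n::nat. box (- (real n *\<^sub>R One)) (real n *\<^sub>R One) :: 'a set"
  show "range ?A \<subseteq> ?E" "(\<Union>i. ?A i) = UNIV"
    unfolding UN_box_eq_UNIV by auto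
  show "emeasure M (?A i) \<noteq> \<infinity>" for i
    using finite_measure.emeasure_finite[OF fin] by (simp add: top_unique)
  show "emeasure M X = emeasure N X" if "X \<in> ?E" for X
    using that eq by auto
qed

lemma Basis_matrix: "(Basis :: (real^'n^'m) set) = (\<lambda>(i, k). axis i (axis k 1)) ` UNIV"
  by (auto simp: Basis_vec_def image_iff)

lemma inj_axis_axis: "inj (\<lambda>(i, k). axis i (axis k (1::real)) :: real^'n^'m)"
  by (auto simp: inj_on_def axis_eq_axis)

lemma borel_measurable_matrixI:
  fixes G :: "'a \<Rightarrow> real^'n^'m"
  assumes "\<And>i k. (\<lambda>\<omega>. G \<omega> $ i $ k) \<in> borel_measurable M"
  shows "G \<in> borel_measurable M"
  unfolding borel_measurable_euclidean_space[of G] Basis_matrix using assms by (auto simp: inner_axis)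

lemma normalized_gaussian_matrix_measurable:
  assumes "normalized_gaussian_matrix M G"
  shows "G \<in> borel_measurable M"
proof (rule borel_measurable_matrixI)
  fix i k
  have "distributed M lborel (\<lambda>\<omega>. G \<omega> $ i $ k) (normal_density 0 (1 / sqrt (real CARD('b))))"
    using assms by (simp add: normalized_gaussian_matrix_def)
  from distributed_measurable[OF this] show "(\<lambda>\<omega>. G \<omega> $ i $ k) \<in> borel_measurable M" by simp
qed

text \<open>Open boxes determine a finite Borel measure, and on a box both sides are the same
  product of one-dimensional normal probabilities, by independence of the entries on one side and by
  the product density on the other.\<close>

lemma distr_normalized_gaussian_matrix:
  fixes G :: "'a \<Rightarrow> real^'n^'n"
  assumes M: "prob_space M" and G: "normalized_gaussian_matrix M G"
  shows "distr M borel (\<lambda>\<omega>. sqrt CARD('n) *\<^sub>R G \<omega>) = std_gaussian"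
proof (rule measure_eqI_box)
  interpret prob_space M by (rule M)
  let ?s = "sqrt (real CARD('n))"
  let ?N = "density lborel std_normal_density"
  have s: "?s > 0" by simp
  have Gm [measurable]: "G \<in> borel_measurable M"
    by (rule normalized_gaussian_matrix_measurable[OF G])
  interpret D: prob_space "distr M borel (\<lambda>\<omega>. ?s *\<^sub>R G \<omega>)"
    by (rule prob_space_distr) simp
  show "finite_measure (distr M borel (\<lambda>\<omega>. ?s *\<^sub>R G \<omega>))"
    by (rule prob_space.axioms(1)) (rule D.prob_space_axioms)
  fix l u :: "real^'n^'n"
  define X where "X = (\<lambda>(i, k) \<omega>. G \<omega> $ i $ k)"
  have ind: "indep_vars (\<lambda>_. borel) X UNIV"
    using G by (simp add: normalized_gaussian_matrix_def X_def)
  define A where "A = (\<lambda>(i, k). {x. l $ i $ k < ?s * x \<and> ?s * x < u $ i $ k})"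
  have A [measurable]: "A p \<in> sets borel" for p
    unfolding A_def by (cases p) simp
  have emA: "emeasure M (X p -` A p \<inter> space M) = emeasure ?N {case_prod (\<lambda>i k. l $ i $ k) p <..< case_prod (\<lambda>i k. u $ i $ k) p}" for p
  proof (cases p)
    case (Pair i k)
    have "distributed M lborel (\<lambda>\<omega>. G \<omega> $ i $ k) (normal_density 0 (1 / ?s))"
      using G by (simp add: normalized_gaussian_matrix_def)
    then have "distributed M lborel (\<lambda>\<omega>. (G \<omega> $ i $ k - 0) / (1 / ?s)) std_normal_density"
      using s by (subst normal_standard_normal_convert[symmetric]) auto
    then have d: "distributed M lborel (\<lambda>\<omega>. ?s * G \<omega> $ i $ k) std_normal_density"
      by (simp add: mult.commute)
    have "emeasure ?N {l $ i $ k <..< u $ i $ k} = emeasure (distr M lborel (\<lambda>\<omega>. ?s * G \<omega> $ i $ k)) {l $ i $ k <..< u $ i $ k}"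
      by (simp add: distributed_distr_eq_density[OF d])
    also have "\<dots> = emeasure M ((\<lambda>\<omega>. ?s * G \<omega> $ i $ k) -` {l $ i $ k <..< u $ i $ k} \<inter> space M)"
      using distributed_measurable[OF d] by (intro emeasure_distr) auto
    also have "(\<lambda>\<omega>. ?s * G \<omega> $ i $ k) -` {l $ i $ k <..< u $ i $ k} \<inter> space M = X p -` A p \<inter> space M"
      by (auto simp: X_def A_def Pair)
    finally show ?thesis by (simp add: Pair)
  qed
  have "(\<lambda>\<omega>. ?s *\<^sub>R G \<omega>) -` box l u \<inter> space M = (\<Inter>p\<in>UNIV. X p -` A p \<inter> space M)"
    by (auto simp: mem_box Basis_matrix X_def A_def inner_axis)
  then have "emeasure (distr M borel (\<lambda>\<omega>. ?s *\<^sub>R G \<omega>)) (box l u) = emeasure M (\<Inter>p\<in>UNIV. X p -` A p \<inter> space M)"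
    by (simp add: emeasure_distr)
  also have "\<dots> = ennreal (\<Prod>p\<in>UNIV. prob (X p -` A p \<inter> space M))"
    unfolding emeasure_eq_measure by (subst indep_varsD_finite[OF ind]) auto
  also have "\<dots> = (\<Prod>p\<in>UNIV. emeasure ?N {case_prod (\<lambda>i k. l $ i $ k) p <..< case_prod (\<lambda>i k. u $ i $ k) p})"
    by (simp add: prod_ennreal[symmetric] emeasure_eq_measure[symmetric] emA)
  also have "\<dots> = (\<Prod>b\<in>(Basis :: (real^'n^'n) set). emeasure ?N {l \<bullet> b <..< u \<bullet> b})"
    unfolding Basis_matrix by (subst prod.reindex[OF inj_axis_axis]) (auto simp: inner_axis case_prod_beta intro!: prod.cong)
  also have "\<dots> = (\<Prod>b\<in>(Basis :: (real^'n^'n) set). \<integral>\<^sup>+x. indicator {l \<bullet> b <..< u \<bullet> b} x \<partial>?N)"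
    by simp
  also have "\<dots> = (\<integral>\<^sup>+z. (\<Prod>b\<in>Basis. indicator {l \<bullet> b <..< u \<bullet> b} (z \<bullet> b)) \<partial>(std_gaussian :: (real^'n^'n) measure))"
    by (rule nn_integral_std_gaussian_prod[symmetric]) simp
  also have "\<dots> = (\<integral>\<^sup>+z. indicator (box l u) z \<partial>std_gaussian)"
  proof (rule nn_integral_cong)
    fix z :: "real^'n^'n"
    show "(\<Prod>b\<in>Basis. indicator {l \<bullet> b <..< u \<bullet> b} (z \<bullet> b)) = (indicator (box l u) z :: ennreal)"
      by (auto simp: indicator_def mem_box prod_zero_iff)
  qed
  also have "\<dots> = emeasure std_gaussian (box l u)" by simp
  finally show "emeasure (distr M borel (\<lambda>\<omega>. ?s *\<^sub>R G \<omega>)) (box l u) = emeasure std_gaussian (box l u)" .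
qed simp_all

lemma convex_on_affine:
  assumes h: "convex_on UNIV h" and L: "linear L"
  shows "convex_on UNIV (\<lambda>y. h (c + L y))"
proof (rule convex_onI)
  fix t x y assume t: "0 < (t::real)" "t < 1"
  have "c + L ((1 - t) *\<^sub>R x + t *\<^sub>R y) = (1 - t) *\<^sub>R (c + L x) + t *\<^sub>R (c + L y)"
    by (simp only: linear_add[OF L] linear_scale[OF L]) (simp add: algebra_simps)
  then show "h (c + L ((1 - t) *\<^sub>R x + t *\<^sub>R y)) \<le> (1 - t) * h (c + L x) + t * h (c + L y)"
    using convex_onD[OF h, of t "c + L x" "c + L y"] t by simp
qed simp

lemma linear_borel_measurable:
  fixes L :: "'a::euclidean_space \<Rightarrow> 'b::euclidean_space"
  shows "linear L \<Longrightarrow> L \<in> borel \<rightarrow>\<^sub>M borel"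
  by (intro borel_measurable_continuous_onI linear_continuous_on) (simp add: linear_conv_bounded_linear)

lemma nn_integral_PiM_convex_order:
  fixes \<mu> \<nu> :: "'i \<Rightarrow> 'e::euclidean_space measure" and h :: "'v::euclidean_space \<Rightarrow> real"
  assumes I: "finite I"
    and p: "\<And>i. prob_space (\<mu> i)" "\<And>i. prob_space (\<nu> i)"
    and s: "\<And>i. sets (\<mu> i) = sets borel" "\<And>i. sets (\<nu> i) = sets borel"
    and le: "\<And>i g. i \<in> I \<Longrightarrow> convex_on UNIV g \<Longrightarrow> (\<And>x. 0 \<le> g x) \<Longrightarrow>
       (\<integral>\<^sup>+x. ennreal (g x) \<partial>\<mu> i) \<le> (\<integral>\<^sup>+x. ennreal (g x) \<partial>\<nu> i)"
    and L: "\<And>i. linear (L i)"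
    and h: "convex_on UNIV h" "\<And>x. 0 \<le> h x"
  shows "(\<integral>\<^sup>+x. ennreal (h (v + (\<Sum>i\<in>I. L i (x i)))) \<partial>PiM I \<mu>) \<le> (\<integral>\<^sup>+x. ennreal (h (v + (\<Sum>i\<in>I. L i (x i)))) \<partial>PiM I \<nu>)"
  using I le
proof (induction I arbitrary: v rule: finite_induct)
  case empty
  show ?case by (simp add: PiM_empty)
next
  case (insert i I)
  interpret \<mu>: product_sigma_finite \<mu>
    by (intro product_sigma_finite.intro prob_space_imp_sigma_finite p)
  interpret \<nu>: product_sigma_finite \<nu>
    by (intro product_sigma_finite.intro prob_space_imp_sigma_finite p)
  interpret \<nu>I: prob_space "PiM I \<nu>" by (intro prob_space_PiM p)
  interpret \<mu>i: prob_space "\<mu> i" by (rule p)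
  interpret P: pair_sigma_finite "PiM I \<nu>" "\<mu> i" ..
  note [measurable_cong] = s
  have [measurable]: "h \<in> borel_measurable borel"
    by (intro borel_measurable_continuous_onI convex_on_continuous h) simp
  have [measurable]: "L j \<in> borel \<rightarrow>\<^sub>M borel" for j by (intro linear_borel_measurable L)
  let ?F = "\<lambda>x y. ennreal (h (v + L i y + (\<Sum>j\<in>I. L j (x j))))"
  have upd: "ennreal (h (v + (\<Sum>j\<in>insert i I. L j ((x(i := y)) j)))) = ?F x y" for x y
  proof -
    have "(\<Sum>j\<in>I. L j ((x(i := y)) j)) = (\<Sum>j\<in>I. L j (x j))"
      using insert.hyps by (intro sum.cong) auto
    then show ?thesis using insert.hyps by (simp add: add.assoc)
  qed
  have "(\<integral>\<^sup>+x. ennreal (h (v + (\<Sum>j\<in>insert i I. L j (x j)))) \<partial>PiM (insert i I) \<mu>)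
      = (\<integral>\<^sup>+y. \<integral>\<^sup>+x. ?F x y \<partial>PiM I \<mu> \<partial>\<mu> i)"
    using insert.hyps by (subst \<mu>.product_nn_integral_insert_rev) (simp_all only: upd, measurable)
  also have "\<dots> \<le> (\<integral>\<^sup>+y. \<integral>\<^sup>+x. ?F x y \<partial>PiM I \<nu> \<partial>\<mu> i)"
    using insert.prems by (intro nn_integral_mono insert.IH) auto
  \<comment> \<open>The other coordinates now follow \<nu>; exchanging the integrals makes
    coordinate \<open>i\<close> the innermost, ready for its own replacement.\<close>
  also have "\<dots> = (\<integral>\<^sup>+x. \<integral>\<^sup>+y. ?F x y \<partial>\<mu> i \<partial>PiM I \<nu>)"
    by (rule P.Fubini') measurable
  also have "\<dots> \<le> (\<integral>\<^sup>+x. \<integral>\<^sup>+y. ?F x y \<partial>\<nu> i \<partial>PiM I \<nu>)"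
  proof (rule nn_integral_mono)
    fix x
    have "convex_on UNIV (\<lambda>y. h ((v + (\<Sum>j\<in>I. L j (x j))) + L i y))"
      by (intro convex_on_affine h L)
    then show "(\<integral>\<^sup>+y. ?F x y \<partial>\<mu> i) \<le> (\<integral>\<^sup>+y. ?F x y \<partial>\<nu> i)"
      by (intro insert.prems) (simp_all add: h algebra_simps)
  qed
  also have "\<dots> = (\<integral>\<^sup>+x. ennreal (h (v + (\<Sum>j\<in>insert i I. L j (x j)))) \<partial>PiM (insert i I) \<nu>)"
    using insert.hyps by (subst \<nu>.product_nn_integral_insert) (simp_all only: upd, measurable)
  finally show ?case .
qed

lemma (in prob_space) nn_integral_indep_vars:
  fixes X :: "'i \<Rightarrow> 'a \<Rightarrow> 'b::topological_space"
  assumes ind: "indep_vars (\<lambda>_. borel) X I"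
    and F: "F \<in> borel_measurable (PiM I (\<lambda>_. borel :: 'b measure))"
  shows "(\<integral>\<^sup>+\<omega>. F (\<lambda>i\<in>I. X i \<omega>) \<partial>M) = (\<integral>\<^sup>+x. F x \<partial>PiM I (\<lambda>i. distr M borel (X i)))"
\<comment> \<open>The empty family, which occurs for \<open>J = 0\<close>, has a point mass as its
  product and is evaluated directly.\<close>
proof (cases "I = {}")
  case True
  then show ?thesis
    by (simp add: PiM_empty nn_integral_count_space_finite emeasure_space_1 restrict_def)
next
  case False
  have X: "X i \<in> borel_measurable M" if "i \<in> I" for i
    using ind that by (auto simp: indep_vars_def)
  have "(\<integral>\<^sup>+\<omega>. F (\<lambda>i\<in>I. X i \<omega>) \<partial>M) = (\<integral>\<^sup>+x. F x \<partial>distr M (PiM I (\<lambda>_. borel)) (\<lambda>\<omega>. \<lambda>i\<in>I. X i \<omega>))"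
    using F X by (subst nn_integral_distr) (auto intro!: measurable_restrict)
  also have "distr M (PiM I (\<lambda>_. borel)) (\<lambda>\<omega>. \<lambda>i\<in>I. X i \<omega>) = PiM I (\<lambda>i. distr M borel (X i))"
    using indep_vars_iff_distr_eq_PiM'[OF False, where M' = "\<lambda>_. borel" and X = X] X ind by simp
  finally show ?thesis .
qed

text \<open>The negative part is at most that of the constant \<open>c\<close>, so its integral is
  finite and no difference of infinities arises. This reduces inequalities between extended
  expectations to ones between integrals of nonnegative functions.\<close>

lemma (in prob_space) ext_expectation_bounded_below:
  assumes [measurable]: "X \<in> borel_measurable M" and X: "\<And>\<omega>. c \<le> X \<omega>"
  shows "ext_expectation M X = enn2ereal (\<integral>\<^sup>+\<omega>. ennreal (X \<omega> - c) \<partial>M) + ereal c"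
proof -
  let ?A = "\<integral>\<^sup>+\<omega>. ennreal (X \<omega>) \<partial>M" and ?B = "\<integral>\<^sup>+\<omega>. ennreal (- X \<omega>) \<partial>M"
    and ?I = "\<integral>\<^sup>+\<omega>. ennreal (X \<omega> - c) \<partial>M"
  \<comment> \<open>The decomposition of \<open>X \<omega>\<close> and \<open>c\<close> into
    positive and negative parts, arranged without subtraction so that it can be integrated in
    \<open>ennreal\<close>.\<close>
  have "ennreal (X \<omega>) + ennreal (- c) = ennreal (X \<omega> - c) + ennreal c + ennreal (- X \<omega>)" for \<omega>
    using X[of \<omega>]
    by (cases "0 \<le> c"; cases "0 \<le> X \<omega>") (simp_all add: ennreal_neg flip: ennreal_plus)
  then have "(\<integral>\<^sup>+\<omega>. ennreal (X \<omega>) + ennreal (- c) \<partial>M) = (\<integral>\<^sup>+\<omega>. ennreal (X \<omega> - c) + ennreal c + ennreal (- X \<omega>) \<partial>M)"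
    by simp
  then have eq: "?A + ennreal (- c) = ?I + ennreal c + ?B"
    by (simp add: nn_integral_add emeasure_space_1)
  have "?B \<le> (\<integral>\<^sup>+\<omega>. ennreal (- c) \<partial>M)"
    using X by (intro nn_integral_mono ennreal_leI) simp
  then have B: "?B \<le> ennreal (- c)" by (simp add: emeasure_space_1)
  then obtain b where b: "?B = ennreal b" "b \<ge> 0"
    by (cases ?B) (auto simp: top_unique)
  show ?thesis
  proof (cases ?I)
    case (real r)
    obtain a where a: "?A = ennreal a" "a \<ge> 0"
      using eq unfolding b real by (cases ?A) (auto simp: ennreal_add_eq_top dest: sym)
    have "a - b = r + c"
    proof (cases "0 \<le> c")
      case True
      then have "ennreal a = ennreal (r + c + b)"
        using eq a b real by (simp add: ennreal_neg)
      then have "a = r + c + b" by (subst (asm) ennreal_inj) (use a b real True in auto)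
      then show ?thesis by simp
    next
      case False
      then have "ennreal (a - c) = ennreal (r + b)"
        using eq a b real ennreal_plus[of a "- c"] by (simp add: ennreal_neg)
      then have "a - c = r + b" by (subst (asm) ennreal_inj) (use a b real False in auto)
      then show ?thesis by simp
    qed
    then show ?thesis
      unfolding ext_expectation_def a b real using a b real by simp
  next
    case top
    then have "?A = top" using eq by (cases ?A) auto
    then show ?thesis
      unfolding ext_expectation_def b top using b by (simp add: enn2ereal_top)
  qed
qed

theorem theorem2:
  fixes A :: "nat \<Rightarrow> real^'n^'n"
    and J :: nat
    and M :: "'a measure" and N :: "'b measure"
    and Q :: "nat \<Rightarrow> 'a \<Rightarrow> real^'n^'n"
    and G :: "nat \<Rightarrow> 'b \<Rightarrow> real^'n^'n"
    and f :: "real^'n^'n \<Rightarrow> real"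
    and \<Phi> :: "real \<Rightarrow> real"
  assumes "prob_space M" and "prob_space N"
    and "\<And>j. j \<in> {1..J} \<Longrightarrow> random_orthogonal_matrix M (Q j)"
    and "prob_space.indep_vars M (\<lambda>_. borel) Q {1..J}"
    and "\<And>j. j \<in> {1..J} \<Longrightarrow> normalized_gaussian_matrix N (G j)"
    and "prob_space.indep_vars N (\<lambda>_. borel) G {1..J}"
    and "\<And>B. 0 \<le> f B" and "sublinear f"
    and "mono \<Phi>" and "convex_on UNIV \<Phi>"
  shows "ext_expectation M (\<lambda>\<omega>. \<Phi> (f (\<Sum>j=1..J. Q j \<omega> ** A j)))
       \<le> ext_expectation N (\<lambda>\<omega>. \<Phi> (3 / 2 * f (\<Sum>j=1..J. G j \<omega> ** A j)))"
proof -
  interpret M: prob_space M by fact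
  interpret N: prob_space N by fact
  let ?J = "{1..J}" and ?s = "sqrt (real CARD('n))"
  have f: "convex_on UNIV f" "\<And>t x. t > 0 \<Longrightarrow> f (t *\<^sub>R x) = t * f x"
    using \<open>sublinear f\<close> by (auto simp: sublinear_def)
  \<comment> \<open>As \<open>f\<close> is nonnegative and \<Phi> increasing,
    \<open>\<Phi> 0\<close> is a lower bound; subtracting it gives the nonnegative convex function
    to which the comparison applies.\<close>
  define h where "h X = \<Phi> (f X) - \<Phi> 0" for X
  have h0: "0 \<le> h X" for X
    using monoD[OF \<open>mono \<Phi>\<close> assms(7)[of X]] by (simp add: h_def)
  have hc: "convex_on UNIV h"
  proof (rule convex_onI)
    fix t :: real and X Y :: "real^'n^'n" assume t: "0 < t" "t < 1"
    have "\<Phi> (f ((1 - t) *\<^sub>R X + t *\<^sub>R Y)) \<le> \<Phi> ((1 - t) * f X + t * f Y)"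
      using convex_onD[OF f(1), of t X Y] t by (intro monoD[OF \<open>mono \<Phi>\<close>]) simp
    also have "\<dots> \<le> (1 - t) * \<Phi> (f X) + t * \<Phi> (f Y)"
      using convex_onD[OF \<open>convex_on UNIV \<Phi>\<close>, of t "f X" "f Y"] t by simp
    finally show "h ((1 - t) *\<^sub>R X + t *\<^sub>R Y) \<le> (1 - t) * h X + t * h Y"
      by (simp add: h_def algebra_simps)
  qed simp
  have [measurable]: "h \<in> borel_measurable borel"
    by (intro borel_measurable_continuous_onI convex_on_continuous hc) simp
  have Qm: "Q j \<in> borel_measurable M" if "j \<in> ?J" for j
    using assms(3)[OF that] by (simp add: random_orthogonal_matrix_def)
  have Gm: "G j \<in> borel_measurable N" if "j \<in> ?J" for j
    using assms(5)[OF that] by (rule normalized_gaussian_matrix_measurable)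
  \<comment> \<open>Homogeneity lets the factor 3/2 move from \<open>f\<close> into the matrices, so
    both sides use the same function \<open>h\<close>.\<close>
  define G' where "G' j \<omega> = (3 / 2) *\<^sub>R G j \<omega>" for j \<omega>
  have G'm: "G' j \<in> borel_measurable N" if "j \<in> ?J" for j
    unfolding G'_def using Gm[OF that] by simp
  have G'i: "N.indep_vars (\<lambda>_. borel) G' ?J"
    unfolding G'_def by (rule N.indep_vars_compose2[OF assms(6)]) simp
  \<comment> \<open>The comparison of products asks for probability measures at every index; point
    masses fill the indices outside the family.\<close>
  define \<mu> where "\<mu> j = (if j \<in> ?J then distr M borel (Q j) else return borel 0)" for j
  define \<nu> where "\<nu> j = (if j \<in> ?J then distr N borel (G' j) else return borel 0)" for j
  have P\<mu>: "PiM ?J \<mu> = PiM ?J (\<lambda>j. distr M borel (Q j))" and P\<nu>: "PiM ?J \<nu> = PiM ?J (\<lambda>j. distr N borel (G' j))"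
    by (intro PiM_cong; simp add: \<mu>_def \<nu>_def)+
  define L where "L j X = X ** A j" for j and X :: "real^'n^'n"
  have L: "linear (L j)" for j
    unfolding L_def by (auto intro!: linearI simp: matrix_matrix_mult_def vec_eq_iff algebra_simps sum.distrib sum_distrib_left)
  have [measurable]: "L j \<in> borel \<rightarrow>\<^sub>M borel" for j by (intro linear_borel_measurable L)
  have Fm: "(\<lambda>x. ennreal (h (0 + (\<Sum>j\<in>?J. L j (x j))))) \<in> borel_measurable (PiM ?J (\<lambda>_. borel))"
    by measurable
  have le: "(\<integral>\<^sup>+X. ennreal (g X) \<partial>\<mu> j) \<le> (\<integral>\<^sup>+X. ennreal (g X) \<partial>\<nu> j)"
    if j: "j \<in> ?J" and g: "convex_on UNIV g" "\<And>X. 0 \<le> g X" for j g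
  proof -
    have [measurable]: "g \<in> borel_measurable borel"
      by (intro borel_measurable_continuous_onI convex_on_continuous g) simp
    note [measurable] = Gm[OF j]
    have "haar_orthogonal (\<mu> j)"
      using assms(3)[OF j] j by (simp add: \<mu>_def random_orthogonal_matrix_def)
    from haar_convex_le_gaussian[OF this g]
    have "(\<integral>\<^sup>+X. ennreal (g X) \<partial>\<mu> j) \<le> (\<integral>\<^sup>+X. ennreal (g ((3 / (2 * ?s)) *\<^sub>R X)) \<partial>std_gaussian)" .
    also have "\<dots> = (\<integral>\<^sup>+\<omega>. ennreal (g ((3 / (2 * ?s)) *\<^sub>R (?s *\<^sub>R G j \<omega>))) \<partial>N)"
      unfolding distr_normalized_gaussian_matrix[OF assms(2) assms(5)[OF j], symmetric]
      by (subst nn_integral_distr) auto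
    also have "\<dots> = (\<integral>\<^sup>+X. ennreal (g X) \<partial>\<nu> j)"
      using j G'm[OF j] by (simp add: \<nu>_def nn_integral_distr G'_def)
    finally show ?thesis .
  qed
  have E: "(\<Sum>j\<in>?J. L j ((\<lambda>j\<in>?J. X j \<omega>) j)) = (\<Sum>j\<in>?J. X j \<omega> ** A j)" for X :: "nat \<Rightarrow> 'c \<Rightarrow> real^'n^'n" and \<omega>
    by (intro sum.cong refl) (simp add: L_def)
  have "(\<integral>\<^sup>+\<omega>. ennreal (h (\<Sum>j\<in>?J. Q j \<omega> ** A j)) \<partial>M) = (\<integral>\<^sup>+x. ennreal (h (0 + (\<Sum>j\<in>?J. L j (x j)))) \<partial>PiM ?J \<mu>)"
    using M.nn_integral_indep_vars[OF assms(4) Fm] unfolding E P\<mu> by simp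
  also have "\<dots> \<le> (\<integral>\<^sup>+x. ennreal (h (0 + (\<Sum>j\<in>?J. L j (x j)))) \<partial>PiM ?J \<nu>)"
  proof (rule nn_integral_PiM_convex_order)
    show "prob_space (\<mu> j)" "prob_space (\<nu> j)" for j
      by (auto simp: \<mu>_def \<nu>_def intro!: M.prob_space_distr N.prob_space_distr prob_space_return Qm G'm)
    show "sets (\<mu> j) = sets borel" "sets (\<nu> j) = sets borel" for j
      by (simp_all add: \<mu>_def \<nu>_def)
  qed (simp_all add: le L hc h0 del: atLeastAtMost_iff)
  also have "\<dots> = (\<integral>\<^sup>+\<omega>. ennreal (h (\<Sum>j\<in>?J. G' j \<omega> ** A j)) \<partial>N)"
    using N.nn_integral_indep_vars[OF G'i Fm] unfolding E P\<nu> by simp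
  finally have main: "(\<integral>\<^sup>+\<omega>. ennreal (h (\<Sum>j\<in>?J. Q j \<omega> ** A j)) \<partial>M) \<le> (\<integral>\<^sup>+\<omega>. ennreal (h (\<Sum>j\<in>?J. G' j \<omega> ** A j)) \<partial>N)" .
  have G'f: "f (\<Sum>j\<in>?J. G' j \<omega> ** A j) = 3 / 2 * f (\<Sum>j\<in>?J. G j \<omega> ** A j)" for \<omega>
  proof -
    have "(\<Sum>j\<in>?J. G' j \<omega> ** A j) = (3 / 2) *\<^sub>R (\<Sum>j\<in>?J. G j \<omega> ** A j)"
      by (simp add: G'_def scaleR_sum_right linear_scale[OF L, unfolded L_def])
    then show ?thesis by (simp add: f(2))
  qed
  \<comment> \<open>Measurability comes from continuity of the convex function \<open>h\<close>,
    which differs from this one by a constant.\<close>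
  have hm: "(\<lambda>X. \<Phi> (f X)) \<in> borel_measurable borel"
  proof -
    have "(\<lambda>X. h X + \<Phi> 0) \<in> borel_measurable borel" by measurable
    then show ?thesis by (simp add: h_def)
  qed
  have "(\<lambda>\<omega>. \<Sum>j\<in>?J. L j (Q j \<omega>)) \<in> borel_measurable M"
    by (intro borel_measurable_sum measurable_compose[OF Qm]) auto
  then have m1: "(\<lambda>\<omega>. \<Phi> (f (\<Sum>j\<in>?J. Q j \<omega> ** A j))) \<in> borel_measurable M"
    unfolding L_def by (rule measurable_compose[OF _ hm])
  have "(\<lambda>\<omega>. \<Sum>j\<in>?J. L j (G' j \<omega>)) \<in> borel_measurable N"
    by (intro borel_measurable_sum measurable_compose[OF G'm]) auto
  then have m2: "(\<lambda>\<omega>. \<Phi> (f (\<Sum>j\<in>?J. G' j \<omega> ** A j))) \<in> borel_measurable N"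
    unfolding L_def by (rule measurable_compose[OF _ hm])
  have \<Phi>0: "\<Phi> 0 \<le> \<Phi> (f X)" for X using h0[of X] by (simp add: h_def)
  show ?thesis
    unfolding G'f[symmetric]
      M.ext_expectation_bounded_below[OF m1 \<Phi>0] N.ext_expectation_bounded_below[OF m2 \<Phi>0]
    using main unfolding h_def by (intro add_right_mono) (simp add: less_eq_ennreal.rep_eq)
qed

end
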